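(* Let $G$ be a finite group and let $W$ be an associative $G$-graded twisted $\mathbb{C}$-algebra. Fix a basis $B=\{v_g: g\in G\}$ of $W$ with $v_g\in W_g$ and $v_e=1$, let $C$ be the structure constant with respect to $B$, and let $A\subset\mathbb{C}^*$ be a subgroup containing the values of $C$. Then $W$ is isomorphic as a $\mathbb{C}$-algebra (ignoring the grading) to a finite product of matrix algebras $\prod_i \mathrm{Mat}_{n_i\times n_i}(\mathbb{C})$, where $n_i=\dim_{\mathbb{C}} V_i$ for a finite list of pairwise non-isomorphic finite-dimensional irreducible complex representations $V_i$ of the group $A\times_C G$. The algebra $W$ is commutative if and only if $n_i=1$ for all $i$, and therefore if and only if $W\cong\mathbb{C}\times\cdots\times\mathbb{C}$.
   Context: A $G$-graded twisted $\mathbb{C}$-algebra is a $\mathbb{C}$-algebra $W$ with a grading $W=\bigoplus_{g\in G}W_g$, $W_aW_b\subset W_{ab}$, such that each $W_g$ is one-dimensional over $\mathbb{C}$, $w_aw_b\neq 0$ for all nonzero $w_a\in W_a$, $w_b\in W_b$, and $W$ has an identity element $1\in W_e$, where $e$ is the identity of $G$. The structure constant with respect to $B$ is the function $C:G\times G\to\mathbb{C}^*$ determined by $v_av_b=C(a,b)v_{ab}$. $A\times_C G$ is the set $A\times G$ with operation $(\alpha,a)\cdot(\beta,b)=(\alpha\beta C(a,b),ab)$; since $W$ is associative, this is a group. *)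

theory Defs
  imports
    "HOL-Algebra.Group_Action"
    "HOL-Algebra.Multiplicative_Group"
    "HOL-Algebra.QuotRing"
    "Jordan_Normal_Form.VS_Connect"
begin

abbreviation complex_field :: "complex ring" where
  "complex_field \<equiv> class_ring"


subsection \<open>Complex algebras\<close>

text \<open>
  A \<open>\<complex>\<close>-algebra is a complex vector space with a bilinear multiplication. Neither associativity nor
  a unit is assumed here, and the fields \<open>one\<close> and \<open>mult\<close> of the record carry no other
  requirements. (The library locale \<^locale>\<open>algebra\<close> does not fit: it covers commutative algebras
  only.)
\<close>

locale complex_algebra = vectorspace complex_field W for W :: "(complex, 'w) module" (structure) +
  assumes mult_closed: "\<lbrakk>x \<in> carrier W; y \<in> carrier W\<rbrakk> \<Longrightarrow> x \<otimes> y \<in> carrier W"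
    and mult_add_left: "\<lbrakk>x \<in> carrier W; y \<in> carrier W; z \<in> carrier W\<rbrakk>
      \<Longrightarrow> (x \<oplus> y) \<otimes> z = x \<otimes> z \<oplus> y \<otimes> z"
    and mult_add_right: "\<lbrakk>x \<in> carrier W; y \<in> carrier W; z \<in> carrier W\<rbrakk>
      \<Longrightarrow> x \<otimes> (y \<oplus> z) = x \<otimes> y \<oplus> x \<otimes> z"
    and mult_smult_left: "\<lbrakk>x \<in> carrier W; y \<in> carrier W\<rbrakk> \<Longrightarrow> (c \<odot> x) \<otimes> y = c \<odot> (x \<otimes> y)"
    and mult_smult_right: "\<lbrakk>x \<in> carrier W; y \<in> carrier W\<rbrakk> \<Longrightarrow> x \<otimes> (c \<odot> y) = c \<odot> (x \<otimes> y)"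

definition algebra_isomorphic :: "(complex, 'v) module \<Rightarrow> (complex, 'w) module \<Rightarrow> bool" where
  "algebra_isomorphic V W \<longleftrightarrow>
    (\<exists>f \<in> ring_iso V W. \<forall>c. \<forall>x \<in> carrier V. f (c \<odot>\<^bsub>V\<^esub> x) = c \<odot>\<^bsub>W\<^esub> f x)"

definition product_algebra ::
  "'i set \<Rightarrow> ('i \<Rightarrow> (complex, 'w) module) \<Rightarrow> (complex, 'i \<Rightarrow> 'w) module" where
  "product_algebra I M =
    \<lparr>carrier = (\<Pi>\<^sub>E i\<in>I. carrier (M i)),
     mult = (\<lambda>x y. \<lambda>i\<in>I. x i \<otimes>\<^bsub>M i\<^esub> y i),
     one = (\<lambda>i\<in>I. \<one>\<^bsub>M i\<^esub>),
     zero = (\<lambda>i\<in>I. \<zero>\<^bsub>M i\<^esub>),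
     add = (\<lambda>x y. \<lambda>i\<in>I. x i \<oplus>\<^bsub>M i\<^esub> y i),
     smult = (\<lambda>c x. \<lambda>i\<in>I. c \<odot>\<^bsub>M i\<^esub> x i)\<rparr>"

text \<open>For square matrices, \<^const>\<open>module_mat\<close> already contains the matrix product and the identity
  matrix.\<close>

abbreviation matrix_algebra :: "nat \<Rightarrow> (complex, complex mat) module" where
  "matrix_algebra n \<equiv> module_mat TYPE(complex) n n"

definition scalar_algebra :: "(complex, complex) module" where
  "scalar_algebra =
    \<lparr>carrier = UNIV, mult = (*), one = 1, zero = 0, add = (+), smult = (*)\<rparr>"


subsection \<open>Graded twisted algebras\<close>

locale graded_twisted_algebra = complex_algebra W + G: group G
  for G :: "'g monoid" and W :: "(complex, 'w) module" (structure)
    and grade :: "'g \<Rightarrow> 'w set" +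
  assumes grade_subspace: "a \<in> carrier G \<Longrightarrow> subspace complex_field (grade a) W"
    and direct_sum_decomposition: "w \<in> carrier W \<Longrightarrow>
      \<exists>!f. f \<in> (\<Pi>\<^sub>E a\<in>carrier G. grade a) \<and> finite {a \<in> carrier G. f a \<noteq> \<zero>} \<and>
           w = (\<Oplus>a\<in>{a \<in> carrier G. f a \<noteq> \<zero>}. f a)"
    and grade_mult: "\<lbrakk>a \<in> carrier G; b \<in> carrier G; x \<in> grade a; y \<in> grade b\<rbrakk>
      \<Longrightarrow> x \<otimes> y \<in> grade (a \<otimes>\<^bsub>G\<^esub> b)"
    and grade_fin_dim: "a \<in> carrier G \<Longrightarrow> vectorspace.fin_dim complex_field (W\<lparr>carrier := grade a\<rparr>)"
    and grade_dim: "a \<in> carrier G \<Longrightarrow> vectorspace.dim complex_field (W\<lparr>carrier := grade a\<rparr>) = 1"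
    and grade_mult_nonzero: "\<lbrakk>a \<in> carrier G; b \<in> carrier G; x \<in> grade a; y \<in> grade b;
      x \<noteq> \<zero>; y \<noteq> \<zero>\<rbrakk> \<Longrightarrow> x \<otimes> y \<noteq> \<zero>"
    and one_grade: "\<one> \<in> grade \<one>\<^bsub>G\<^esub>"
    and one_mult_left: "x \<in> carrier W \<Longrightarrow> \<one> \<otimes> x = x"
    and one_mult_right: "x \<in> carrier W \<Longrightarrow> x \<otimes> \<one> = x"

definition graded_basis ::
  "'g monoid \<Rightarrow> (complex, 'w) module \<Rightarrow> ('g \<Rightarrow> 'w set) \<Rightarrow> ('g \<Rightarrow> 'w) \<Rightarrow> bool" where
  "graded_basis G W grade v \<longleftrightarrow>
    (\<forall>a \<in> carrier G. v a \<in> grade a) \<and>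
    vectorspace.basis complex_field W (v ` carrier G) \<and>
    v \<one>\<^bsub>G\<^esub> = \<one>\<^bsub>W\<^esub>"

text \<open>The values of \<open>C\<close> outside \<open>carrier G \<times> carrier G\<close> are irrelevant.\<close>

definition structure_constant ::
  "'g monoid \<Rightarrow> (complex, 'w) module \<Rightarrow> ('g \<Rightarrow> 'w) \<Rightarrow> ('g \<Rightarrow> 'g \<Rightarrow> complex) \<Rightarrow> bool" where
  "structure_constant G W v C \<longleftrightarrow>
    (\<forall>a \<in> carrier G. \<forall>b \<in> carrier G.
      C a b \<noteq> 0 \<and> v a \<otimes>\<^bsub>W\<^esub> v b = C a b \<odot>\<^bsub>W\<^esub> v (a \<otimes>\<^bsub>G\<^esub> b))"

text \<open>The unit is \<open>(1, e)\<close> because \<open>v e = 1\<close> forces \<open>C e a = C a e = 1\<close>; see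
  \<open>twisted_product_group\<close> below.\<close>

definition twisted_product ::
  "complex set \<Rightarrow> ('g \<Rightarrow> 'g \<Rightarrow> complex) \<Rightarrow> 'g monoid \<Rightarrow> (complex \<times> 'g) monoid" where
  "twisted_product A C G =
    \<lparr>carrier = A \<times> carrier G,
     mult = (\<lambda>(\<alpha>, a) (\<beta>, b). (\<alpha> * \<beta> * C a b, a \<otimes>\<^bsub>G\<^esub> b)),
     one = (1, \<one>\<^bsub>G\<^esub>)\<rparr>"

lemma twisted_product_group:
  assumes "graded_twisted_algebra G W grade"
    and associative: "\<And>x y z. \<lbrakk>x \<in> carrier W; y \<in> carrier W; z \<in> carrier W\<rbrakk>
      \<Longrightarrow> (x \<otimes>\<^bsub>W\<^esub> y) \<otimes>\<^bsub>W\<^esub> z = x \<otimes>\<^bsub>W\<^esub> (y \<otimes>\<^bsub>W\<^esub> z)"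
    and basis: "graded_basis G W grade v"
    and const: "structure_constant G W v C"
    and A: "subgroup A (mult_of complex_field)"
    and C_in_A: "\<And>a b. \<lbrakk>a \<in> carrier G; b \<in> carrier G\<rbrakk> \<Longrightarrow> C a b \<in> A"
  shows "group (twisted_product A C G)"
proof -
  interpret graded_twisted_algebra G W grade by fact
  have sub: "v ` carrier G \<subseteq> carrier W" and indpt: "lin_indpt (v ` carrier G)"
    and v_one: "v \<one>\<^bsub>G\<^esub> = \<one>\<^bsub>W\<^esub>"
    using basis by (auto simp: graded_basis_def basis_def)
  have v_in: "v a \<in> carrier W" if "a \<in> carrier G" for a
    using sub that by auto
  have v_nonzero: "v a \<noteq> \<zero>\<^bsub>W\<^esub>" if "a \<in> carrier G" for a
    using vs_zero_lin_dep[OF sub indpt] that by (metis imageI)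
  have smult_in: "c \<odot>\<^bsub>W\<^esub> x \<in> carrier W" if "x \<in> carrier W" for c x
    using that smult_closed[of c x] by simp
  have smult_smult: "c \<odot>\<^bsub>W\<^esub> (d \<odot>\<^bsub>W\<^esub> x) = (c * d) \<odot>\<^bsub>W\<^esub> x" if "x \<in> carrier W" for c d x
    using that smult_assoc1[of c d x] by simp
  have cancel: "c = d" if "c \<odot>\<^bsub>W\<^esub> x = d \<odot>\<^bsub>W\<^esub> x" "x \<in> carrier W" "x \<noteq> \<zero>\<^bsub>W\<^esub>" for c d x
  proof (rule ccontr)
    assume "c \<noteq> d"
    have "(c - d) \<odot>\<^bsub>W\<^esub> x \<oplus>\<^bsub>W\<^esub> d \<odot>\<^bsub>W\<^esub> x = c \<odot>\<^bsub>W\<^esub> x"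
      using smult_l_distr[of "c - d" d x] that(2) by simp
    then have zero: "(c - d) \<odot>\<^bsub>W\<^esub> x = \<zero>\<^bsub>W\<^esub>"
      using that smult_in[OF that(2)] by simp
    have "x = inverse (c - d) \<odot>\<^bsub>W\<^esub> ((c - d) \<odot>\<^bsub>W\<^esub> x)"
      using \<open>c \<noteq> d\<close> that(2) smult_one[of x] by (simp add: smult_smult)
    also have "\<dots> = \<zero>\<^bsub>W\<^esub>"
      using zero smult_r_null[of "inverse (c - d)"] by simp
    finally show False using that(3) by simp
  qed
  have vv: "v a \<otimes>\<^bsub>W\<^esub> v b = C a b \<odot>\<^bsub>W\<^esub> v (a \<otimes>\<^bsub>G\<^esub> b)"
    if "a \<in> carrier G" "b \<in> carrier G" for a b
    using const that by (auto simp: structure_constant_def)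
  have cocycle: "C a b * C (a \<otimes>\<^bsub>G\<^esub> b) c = C b c * C a (b \<otimes>\<^bsub>G\<^esub> c)"
    if "a \<in> carrier G" "b \<in> carrier G" "c \<in> carrier G" for a b c
  proof (rule cancel)
    have "(v a \<otimes>\<^bsub>W\<^esub> v b) \<otimes>\<^bsub>W\<^esub> v c
        = (C a b * C (a \<otimes>\<^bsub>G\<^esub> b) c) \<odot>\<^bsub>W\<^esub> v (a \<otimes>\<^bsub>G\<^esub> b \<otimes>\<^bsub>G\<^esub> c)"
      using that by (simp add: vv v_in mult_smult_left smult_smult)
    moreover have "v a \<otimes>\<^bsub>W\<^esub> (v b \<otimes>\<^bsub>W\<^esub> v c)
        = (C b c * C a (b \<otimes>\<^bsub>G\<^esub> c)) \<odot>\<^bsub>W\<^esub> v (a \<otimes>\<^bsub>G\<^esub> b \<otimes>\<^bsub>G\<^esub> c)"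
      using that by (simp add: vv v_in mult_smult_right smult_smult G.m_assoc)
    ultimately show "(C a b * C (a \<otimes>\<^bsub>G\<^esub> b) c) \<odot>\<^bsub>W\<^esub> v (a \<otimes>\<^bsub>G\<^esub> b \<otimes>\<^bsub>G\<^esub> c)
        = (C b c * C a (b \<otimes>\<^bsub>G\<^esub> c)) \<odot>\<^bsub>W\<^esub> v (a \<otimes>\<^bsub>G\<^esub> b \<otimes>\<^bsub>G\<^esub> c)"
      using associative[of "v a" "v b" "v c"] that v_in by simp
  qed (use that v_in v_nonzero in simp_all)
  have C_one: "C \<one>\<^bsub>G\<^esub> a = 1" if "a \<in> carrier G" for a
    using vv[of "\<one>\<^bsub>G\<^esub>" a] that v_one one_mult_left[of "v a"] v_in[OF that] v_nonzero[OF that]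
      cancel[of "C \<one>\<^bsub>G\<^esub> a" "v a" 1] smult_one[of "v a"] by simp
  have A_nonzero: "x \<noteq> 0" if "x \<in> A" for x
    using subgroup.mem_carrier[OF A that] by simp
  have A_mult: "x * y \<in> A" if "x \<in> A" "y \<in> A" for x y
    using subgroup.m_closed[OF A that] by simp
  have A_one: "1 \<in> A"
    using subgroup.one_closed[OF A] by simp
  interpret M: group "mult_of complex_field" by (rule field.field_mult_group) unfold_locales
  have A_inverse: "inverse x \<in> A" if "x \<in> A" for x
  proof -
    have "x \<in> carrier (mult_of complex_field)" using A_nonzero[OF that] by simp
    then have "inv\<^bsub>mult_of complex_field\<^esub> x * x = 1"
      using M.l_inv[of x] by simp
    then have "inv\<^bsub>mult_of complex_field\<^esub> x = inverse x"
      using A_nonzero[OF that] by (simp add: field_simps)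
    then show ?thesis using subgroup.m_inv_closed[OF A that] by simp
  qed
  show ?thesis
  proof (rule groupI)
    fix x assume "x \<in> carrier (twisted_product A C G)"
    then obtain \<alpha> a where x: "x = (\<alpha>, a)" "\<alpha> \<in> A" "a \<in> carrier G"
      by (auto simp: twisted_product_def)
    let ?y = "(inverse (\<alpha> * C (inv\<^bsub>G\<^esub> a) a), inv\<^bsub>G\<^esub> a)"
    have "?y \<in> carrier (twisted_product A C G)"
      using x by (auto simp: twisted_product_def simp del: inverse_mult_distrib
        intro!: A_inverse A_mult C_in_A)
    moreover have "?y \<otimes>\<^bsub>twisted_product A C G\<^esub> x = \<one>\<^bsub>twisted_product A C G\<^esub>"
      using x A_nonzero[OF x(2)] A_nonzero[OF C_in_A[of "inv\<^bsub>G\<^esub> a" a]]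
      by (simp add: twisted_product_def field_simps)
    ultimately show "\<exists>y \<in> carrier (twisted_product A C G).
        y \<otimes>\<^bsub>twisted_product A C G\<^esub> x = \<one>\<^bsub>twisted_product A C G\<^esub>"
      by blast
  next
    fix x y z
    assume "x \<in> carrier (twisted_product A C G)" "y \<in> carrier (twisted_product A C G)"
      "z \<in> carrier (twisted_product A C G)"
    then show "x \<otimes>\<^bsub>twisted_product A C G\<^esub> y \<otimes>\<^bsub>twisted_product A C G\<^esub> z =
        x \<otimes>\<^bsub>twisted_product A C G\<^esub> (y \<otimes>\<^bsub>twisted_product A C G\<^esub> z)"
      by (auto simp: twisted_product_def G.m_assoc cocycle mult.assoc mult.left_commute)
  qed (auto simp: twisted_product_def C_one A_one intro!: A_mult C_in_A)
qed


subsection \<open>Complex representations\<close>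

text \<open>\<open>\<rho>\<close> is a homomorphism from \<open>H\<close> into the group of permutations of the set \<open>V\<close> (this is
  \<^locale>\<open>group_action\<close>, which also requires \<open>H\<close> to be a group), all of whose values are linear.\<close>

locale representation =
  vectorspace complex_field V + group_action H "carrier V" \<rho>
  for H :: "'h monoid" and V :: "(complex, 'v) module" and \<rho> :: "'h \<Rightarrow> 'v \<Rightarrow> 'v" +
  assumes linear: "h \<in> carrier H \<Longrightarrow> linear_map complex_field V V (\<rho> h)"

definition irreducible_representation ::
  "'h monoid \<Rightarrow> (complex, 'v) module \<Rightarrow> ('h \<Rightarrow> 'v \<Rightarrow> 'v) \<Rightarrow> bool" where
  "irreducible_representation H V \<rho> \<longleftrightarrow>
    representation H V \<rho> \<and> carrier V \<noteq> {\<zero>\<^bsub>V\<^esub>} \<and>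
    (\<forall>U. subspace complex_field U V \<and> (\<forall>h \<in> carrier H. \<forall>x \<in> U. \<rho> h x \<in> U)
      \<longrightarrow> U = {\<zero>\<^bsub>V\<^esub>} \<or> U = carrier V)"

definition representation_isomorphic ::
  "'h monoid \<Rightarrow> (complex, 'v) module \<Rightarrow> ('h \<Rightarrow> 'v \<Rightarrow> 'v)
    \<Rightarrow> (complex, 'u) module \<Rightarrow> ('h \<Rightarrow> 'u \<Rightarrow> 'u) \<Rightarrow> bool" where
  "representation_isomorphic H V \<rho> U \<sigma> \<longleftrightarrow>
    (\<exists>T. linear_map complex_field V U T \<and> bij_betw T (carrier V) (carrier U) \<and>
         (\<forall>h \<in> carrier H. \<forall>x \<in> carrier V. T (\<rho> h x) = \<sigma> h (T x)))"

end

theory Submission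
  imports Defs "Jordan_Normal_Form.Spectral_Radius"
begin

text \<open>
  The structure constants form a normalized 2-cocycle, and the representations of \<open>A \<times>\<^sub>C G\<close> on
  which \<open>A\<close> acts by scalars are the matrix families \<open>\<pi>\<close> with \<open>\<pi> a * \<pi> b = C a b \<cdot>\<^sub>m \<pi> (a \<otimes> b)\<close>
  (projective representations). Each of them extends linearly to an algebra homomorphism
  \<open>v\<^sub>a \<mapsto> \<pi> a\<close> on \<open>W\<close>. Take a maximal family of pairwise non-isomorphic irreducible ones. By Schur
  orthogonality the joint evaluation map from \<open>W\<close> to the product of matrix algebras has an explicit
  right inverse (Fourier inversion), which also bounds the size of such a family by \<open>|G|\<close>. It is
  injective, because by averaging every minimal left ideal of \<open>W\<close> is a direct summand.
\<close>

subsection \<open>Matrices\<close>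

text \<open>Irreducible subrepresentations have to reappear as matrices of their own size. A
  subspace is therefore carried by a matrix \<open>B\<close> of basis columns with a left inverse
  \<open>D\<close>, and invariance under \<open>L\<close> becomes the identity
  \<open>B * (D * (L * B)) = L * B\<close>, which survives composition of such pairs. The cocycle
  spoils the rule that the inverse of the element acts as the inverse matrix: a factor C(a^-1, a)
  appears. With the true inverse matrix in its place the scalars in \<sigma>(a) E \<pi>(a)^-1
  cancel, so averaging works as for ordinary representations. Orthogonality alone gives
  surjectivity, for any pairwise non-isomorphic family of irreducibles; completeness of the family
  is what injectivity rests on. Group representations arise by letting (\<alpha>, a) act as \<alpha>
  \<pi>(a), since the product of A \<times> G collects exactly the factor C(a, b). The elements (1,
  a) recover \<pi>, so irreducibility and non-isomorphism carry over.\<close>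

lemma smult_smult_mat: "a \<cdot>\<^sub>m (b \<cdot>\<^sub>m A) = (a * b) \<cdot>\<^sub>m (A :: 'a :: semigroup_mult mat)"
  by (auto simp: mult.assoc)

lemma mat_eq_on_vecI:
  fixes A :: "'a :: comm_ring_1 mat"
  assumes A: "A \<in> carrier_mat p n" and B: "B \<in> carrier_mat p n"
    and eq: "\<And>x. x \<in> carrier_vec n \<Longrightarrow> A *\<^sub>v x = B *\<^sub>v x"
  shows "A = B"
proof (rule eq_matI)
  fix i j assume "i < dim_row B" "j < dim_col B"
  then have i: "i < p" and j: "j < n" using B by auto
  have "(A *\<^sub>v unit_vec n j) $ i = (B *\<^sub>v unit_vec n j) $ i" using eq by simp
  then show "A $$ (i, j) = B $$ (i, j)" using A B i j by simp
qed (use A B in auto)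

lemma index_mult_mat_sum:
  assumes "A \<in> carrier_mat a b" "B \<in> carrier_mat b c" "i < a" "j < c"
  shows "(A * B) $$ (i, j) = (\<Sum>k<b. A $$ (i, k) * B $$ (k, j))"
  using assms by (auto simp: scalar_prod_def atLeast0LessThan intro!: sum.cong)

lemma index_mult_mat_vec_sum:
  assumes "A \<in> carrier_mat a b" "x \<in> carrier_vec b" "i < a"
  shows "(A *\<^sub>v x) $ i = (\<Sum>k<b. A $$ (i, k) * x $ k)"
  using assms by (auto simp: scalar_prod_def atLeast0LessThan intro!: sum.cong)

text \<open>If n < k, zero padding makes both matrices square, where a left inverse is also a right
  inverse; but row n of the padded \<open>B\<close> vanishes. This is the dimension count behind
  both frames of subspaces and the bound on the number of irreducibles.\<close>

lemma left_inverse_dim_le: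
  fixes B D :: "'a :: field mat"
  assumes B: "B \<in> carrier_mat n k" and D: "D \<in> carrier_mat k n" and DB: "D * B = 1\<^sub>m k"
  shows "k \<le> n"
proof (rule ccontr)
  assume "\<not> k \<le> n"
  then have nk: "n < k" by simp
  define B' where "B' = mat k k (\<lambda>(i, j). if i < n then B $$ (i, j) else 0)"
  define D' where "D' = mat k k (\<lambda>(i, j). if j < n then D $$ (i, j) else 0)"
  have B': "B' \<in> carrier_mat k k" and D': "D' \<in> carrier_mat k k"
    by (auto simp: B'_def D'_def)
  have "D' * B' = 1\<^sub>m k"
  proof (rule eq_matI)
    fix i j assume "i < dim_row (1\<^sub>m k :: 'a mat)" "j < dim_col (1\<^sub>m k :: 'a mat)"
    then have i: "i < k" and j: "j < k" by auto
    have "(D' * B') $$ (i, j) = (\<Sum>l<k. D' $$ (i, l) * B' $$ (l, j))"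
      using D' B' i j by (rule index_mult_mat_sum)
    also have "\<dots> = (\<Sum>l<n. D $$ (i, l) * B $$ (l, j))"
      using nk i j by (intro sum.mono_neutral_cong_right) (auto simp: B'_def D'_def)
    also have "\<dots> = (D * B) $$ (i, j)"
      using D B i j by (rule index_mult_mat_sum[symmetric])
    finally show "(D' * B') $$ (i, j) = 1\<^sub>m k $$ (i, j)" by (simp add: DB)
  qed (use B' D' in auto)
  then have "B' * D' = 1\<^sub>m k"
    by (rule mat_mult_left_right_inverse[OF D' B'])
  then have "1 = (B' * D') $$ (n, n)" using nk by simp
  also have "\<dots> = (\<Sum>l<k. B' $$ (n, l) * D' $$ (l, n))"
    using nk by (intro index_mult_mat_sum[OF B' D'])
  also have "\<dots> = 0" using nk by (intro sum.neutral) (auto simp: B'_def)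
  finally show False by simp
qed

text \<open>Algebraic closedness of the complex numbers enters here, on behalf of Schur's
  lemma.\<close>

lemma exists_eigenvector:
  fixes T :: "complex mat"
  assumes T: "T \<in> carrier_mat n n" and n: "0 < n"
  obtains c x where "x \<in> carrier_vec n" "x \<noteq> 0\<^sub>v n" "T *\<^sub>v x = c \<cdot>\<^sub>v x"
proof -
  from spectrum_non_empty[OF T n] obtain c where "eigenvalue T c"
    by (auto simp: spectrum_def)
  then obtain x where "eigenvector T x c" by (auto simp: eigenvalue_def)
  then show ?thesis using that[of x c] T by (auto simp: eigenvector_def)
qed

lemma subspace_module_vec_iff:
  "subspace complex_field U (module_vec TYPE(complex) n) \<longleftrightarrow>
    U \<subseteq> carrier_vec n \<and> 0\<^sub>v n \<in> U \<and> (\<forall>x \<in> U. \<forall>y \<in> U. x + y \<in> U) \<and> (\<forall>c. \<forall>x \<in> U. c \<cdot>\<^sub>v x \<in> U)"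
  using vec_vs[of n] vec_module[of n]
  by (auto simp: subspace_def submodule_def module_vec_simps)

text \<open>The columns of \<open>B\<close> are a basis of the subspace, and \<open>D\<close> reads off coordinates.\<close>

lemma subspace_frame:
  assumes U: "subspace complex_field U (module_vec TYPE(complex) n)"
  obtains k B D where "B \<in> carrier_mat n k" "D \<in> carrier_mat k n" "D * B = 1\<^sub>m k"
    "U = (\<lambda>x. B *\<^sub>v x) ` carrier_vec k"
proof -
  \<comment> \<open>\<open>P k\<close> holds if U contains k independent vectors, independence being
    certified by the left inverse \<open>D\<close>. A greatest such k must give a basis of
    U.\<close>
  define P where "P k \<longleftrightarrow> (\<exists>B D. B \<in> carrier_mat n k \<and> D \<in> carrier_mat k n \<and> D * B = 1\<^sub>m k \<and>
    (\<forall>x \<in> carrier_vec k. B *\<^sub>v x \<in> U))" for k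
  have Un: "x \<in> carrier_vec n" if "x \<in> U" for x
    using U that by (auto simp: subspace_module_vec_iff)
  have U0: "0\<^sub>v n \<in> U" and Uadd: "\<And>x y. x \<in> U \<Longrightarrow> y \<in> U \<Longrightarrow> x + y \<in> U"
    and Usmult: "\<And>c x. x \<in> U \<Longrightarrow> c \<cdot>\<^sub>v x \<in> U"
    using U by (auto simp: subspace_module_vec_iff)
  have "0\<^sub>m n 0 *\<^sub>v x = (0\<^sub>v n :: complex vec)" if "x \<in> carrier_vec 0" for x
    using that by (auto intro!: eq_vecI simp: scalar_prod_def)
  then have "P 0"
    unfolding P_def by (intro exI[of _ "0\<^sub>m n 0"] exI[of _ "0\<^sub>m 0 n"]) (auto simp: U0)
  moreover have "k \<le> n" if "P k" for k
    using that left_inverse_dim_le unfolding P_def by metis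
  ultimately obtain k where k: "P k" and max: "\<And>l. P l \<Longrightarrow> l \<le> k"
    using ex_has_greatest_nat[of P 0 "\<lambda>x. x" "Suc n"] by (metis le_imp_less_Suc)
  from k obtain B D where B: "B \<in> carrier_mat n k" and D: "D \<in> carrier_mat k n"
    and DB: "D * B = 1\<^sub>m k" and BU: "\<And>x. x \<in> carrier_vec k \<Longrightarrow> B *\<^sub>v x \<in> U"
    by (auto simp: P_def)
  have "y0 \<in> (\<lambda>x. B *\<^sub>v x) ` carrier_vec k" if y0: "y0 \<in> U" for y0
  proof (rule ccontr)
    assume not: "y0 \<notin> (\<lambda>x. B *\<^sub>v x) ` carrier_vec k"
    define z where "z = D *\<^sub>v y0"
    have y0n: "y0 \<in> carrier_vec n" using Un y0 .
    have z: "z \<in> carrier_vec k" using D y0n by (simp add: z_def)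
    have Bz: "B *\<^sub>v z \<in> carrier_vec n" using BU[OF z] Un by auto
    \<comment> \<open>Removing from \<open>y0\<close> its projection under \<open>B * D\<close>
      leaves a vector of U that \<open>D\<close> kills, and it is nonzero because \<open>y0\<close>
      lies outside the column space of \<open>B\<close>.\<close>
    define y where "y = y0 + (-1) \<cdot>\<^sub>v (B *\<^sub>v z)"
    have yU: "y \<in> U" unfolding y_def by (intro Uadd Usmult BU y0 z)
    have yn: "y \<in> carrier_vec n" using Un yU .
    have "D *\<^sub>v y = D *\<^sub>v y0 + (-1) \<cdot>\<^sub>v (D *\<^sub>v (B *\<^sub>v z))"
      unfolding y_def using D y0n Bz by (simp add: mult_add_distrib_mat_vec mult_mat_vec)
    also have "D *\<^sub>v (B *\<^sub>v z) = z"
      using assoc_mult_mat_vec[OF D B z] DB z by simp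
    also have "D *\<^sub>v y0 + (-1) \<cdot>\<^sub>v z = 0\<^sub>v k"
      using z by (intro eq_vecI) (auto simp: z_def[symmetric])
    finally have Dy: "D *\<^sub>v y = 0\<^sub>v k" .
    have "y \<noteq> 0\<^sub>v n"
    proof
      assume "y = 0\<^sub>v n"
      have "y0 = B *\<^sub>v z"
      proof (rule eq_vecI)
        fix i assume i: "i < dim_vec (B *\<^sub>v z)"
        then have "i < n" using B by simp
        have "y $ i = 0" using \<open>y = 0\<^sub>v n\<close> \<open>i < n\<close> by simp
        then show "y0 $ i = (B *\<^sub>v z) $ i"
          using y0n Bz \<open>i < n\<close> i unfolding y_def by (simp del: index_mult_mat_vec)
      qed (use y0n Bz B in auto)
      then show False using not z by auto
    qed
    then obtain i where i: "i < n" and yi: "y $ i \<noteq> 0"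
      using yn by (metis carrier_vecD eq_vecI index_zero_vec)
    \<comment> \<open>The new row of the left inverse: r(h) = (h - B D h)_i / y_i. It vanishes on
      the columns of \<open>B\<close> since B D B = B, and it is 1 on \<open>y\<close> since D y =
      0.\<close>
    define r where "r j = ((if j = i then 1 else 0) - (B * D) $$ (i, j)) / y $ i" for j
    define B' where "B' = mat n (Suc k) (\<lambda>(a, c). if c < k then B $$ (a, c) else y $ a)"
    define D' where "D' = mat (Suc k) n (\<lambda>(c, a). if c < k then D $$ (c, a) else r a)"
    have B': "B' \<in> carrier_mat n (Suc k)" and D': "D' \<in> carrier_mat (Suc k) n"
      by (auto simp: B'_def D'_def)
    have rsum: "(\<Sum>l<n. r l * h l) = (h i - (\<Sum>l<n. (B * D) $$ (i, l) * h l)) / y $ i" for h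
    proof -
      have "(\<Sum>l<n. r l * h l) = (\<Sum>l<n. (if l = i then h l else 0) - (B * D) $$ (i, l) * h l) / y $ i"
        unfolding r_def sum_divide_distrib by (intro sum.cong refl) (auto simp: field_simps)
      also have "\<dots> = (h i - (\<Sum>l<n. (B * D) $$ (i, l) * h l)) / y $ i"
        using i by (simp add: sum_subtractf)
      finally show ?thesis .
    qed
    have BD: "B * D \<in> carrier_mat n n" using B D by simp
    have "D' * B' = 1\<^sub>m (Suc k)"
    proof (rule eq_matI)
      fix c c' assume "c < dim_row (1\<^sub>m (Suc k) :: complex mat)" "c' < dim_col (1\<^sub>m (Suc k) :: complex mat)"
      then have c: "c < Suc k" and c': "c' < Suc k" by auto
      have eq: "(D' * B') $$ (c, c') = (\<Sum>l<n. D' $$ (c, l) * B' $$ (l, c'))"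
        using D' B' c c' by (rule index_mult_mat_sum)
      consider "c < k" "c' < k" | "c < k" "c' = k" | "c = k" "c' < k" | "c = k" "c' = k"
        using c c' by linarith
      then show "(D' * B') $$ (c, c') = 1\<^sub>m (Suc k) $$ (c, c')"
      proof cases
        case 1
        then have "(D' * B') $$ (c, c') = (\<Sum>l<n. D $$ (c, l) * B $$ (l, c'))"
          unfolding eq by (simp add: D'_def B'_def)
        also have "\<dots> = (D * B) $$ (c, c')"
          using D B 1 by (simp only: index_mult_mat_sum)
        finally show ?thesis using 1 by (simp add: DB)
      next
        case 2
        then have "(D' * B') $$ (c, c') = (\<Sum>l<n. D $$ (c, l) * y $ l)"
          unfolding eq by (simp add: D'_def B'_def)
        also have "\<dots> = (D *\<^sub>v y) $ c"
          using D yn 2 by (simp only: index_mult_mat_vec_sum)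
        finally show ?thesis using 2 by (simp add: Dy)
      next
        case 3
        then have "(D' * B') $$ (c, c') = (\<Sum>l<n. r l * B $$ (l, c'))"
          unfolding eq by (simp add: D'_def B'_def)
        also have "\<dots> = (B $$ (i, c') - (B * D * B) $$ (i, c')) / y $ i"
          using BD B 3 i by (simp only: rsum index_mult_mat_sum)
        also have "B * D * B = B"
          using assoc_mult_mat[OF B D B] B by (simp add: DB)
        finally show ?thesis using 3 by simp
      next
        case 4
        then have "(D' * B') $$ (c, c') = (\<Sum>l<n. r l * y $ l)"
          unfolding eq by (simp add: D'_def B'_def)
        also have "\<dots> = (y $ i - (B * D *\<^sub>v y) $ i) / y $ i"
          using BD yn i by (simp only: rsum index_mult_mat_vec_sum)
        also have "B * D *\<^sub>v y = 0\<^sub>v n"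
          using assoc_mult_mat_vec[OF B D yn] B
          by (auto simp: Dy scalar_prod_def intro!: eq_vecI)
        finally show ?thesis using 4 yi i by simp
      qed
    qed (use B' D' in auto)
    moreover have "B' *\<^sub>v x \<in> U" if x: "x \<in> carrier_vec (Suc k)" for x
    proof -
      define x' where "x' = vec k (\<lambda>j. x $ j)"
      have x': "x' \<in> carrier_vec k" by (simp add: x'_def)
      have "B' *\<^sub>v x = B *\<^sub>v x' + x $ k \<cdot>\<^sub>v y"
      proof (rule eq_vecI)
        fix a assume "a < dim_vec (B *\<^sub>v x' + x $ k \<cdot>\<^sub>v y)"
        then have a: "a < n" using B yn by simp
        have "(B' *\<^sub>v x) $ a = (\<Sum>l<Suc k. B' $$ (a, l) * x $ l)"
          using B' x a by (rule index_mult_mat_vec_sum)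
        also have "\<dots> = (\<Sum>l<k. B $$ (a, l) * x' $ l) + y $ a * x $ k"
          using a by (simp add: B'_def x'_def)
        also have "\<dots> = (B *\<^sub>v x') $ a + y $ a * x $ k"
          using B x' a by (simp only: index_mult_mat_vec_sum)
        finally show "(B' *\<^sub>v x) $ a = (B *\<^sub>v x' + x $ k \<cdot>\<^sub>v y) $ a"
          using a B yn by simp
      qed (use B B' yn in auto)
      then show ?thesis using BU[OF x'] yU by (simp add: Uadd Usmult)
    qed
    ultimately have "P (Suc k)" using B' D' by (auto simp: P_def)
    then show False using max by fastforce
  qed
  then show ?thesis using that[OF B D DB] BU by blast
qed

lemma linear_on_vec_eq_mat:
  fixes T :: "complex vec \<Rightarrow> complex vec"
  assumes T: "\<And>x. x \<in> carrier_vec n \<Longrightarrow> T x \<in> carrier_vec p"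
    and add: "\<And>x y. x \<in> carrier_vec n \<Longrightarrow> y \<in> carrier_vec n \<Longrightarrow> T (x + y) = T x + T y"
    and smult: "\<And>c x. x \<in> carrier_vec n \<Longrightarrow> T (c \<cdot>\<^sub>v x) = c \<cdot>\<^sub>v T x"
  obtains M where "M \<in> carrier_mat p n" "\<And>x. x \<in> carrier_vec n \<Longrightarrow> T x = M *\<^sub>v x"
proof
  define M where "M = mat p n (\<lambda>(i, j). T (unit_vec n j) $ i)"
  show M: "M \<in> carrier_mat p n" by (simp add: M_def)
  \<comment> \<open>Induction on a bound k for the support of x; the step splits off the coordinate
    with index k. The bound n then covers all vectors.\<close>
  have "T x = M *\<^sub>v x" if "k \<le> n" "x \<in> carrier_vec n" "\<And>i. k \<le> i \<Longrightarrow> i < n \<Longrightarrow> x $ i = 0" for k x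
    using that
  proof (induction k arbitrary: x)
    case 0
    then have "x = 0 \<cdot>\<^sub>v x" by (intro eq_vecI) auto
    then have "T x = 0 \<cdot>\<^sub>v T x" using smult[OF 0(2), of 0] by simp
    moreover have "M *\<^sub>v x = 0 \<cdot>\<^sub>v (M *\<^sub>v x)"
      using mult_mat_vec[OF M 0(2), of 0] \<open>x = 0 \<cdot>\<^sub>v x\<close> by simp
    moreover have "0 \<cdot>\<^sub>v y = 0\<^sub>v p" if "y \<in> carrier_vec p" for y :: "complex vec"
      using that by (intro eq_vecI) auto
    ultimately show ?case using T[OF 0(2)] M 0(2) by (metis mult_mat_vec_carrier)
  next
    case (Suc k)
    define z where "z = vec n (\<lambda>i. if i = k then 0 else x $ i)"
    have z: "z \<in> carrier_vec n" by (simp add: z_def)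
    have x: "x = z + x $ k \<cdot>\<^sub>v unit_vec n k"
      using Suc.prems by (intro eq_vecI) (auto simp: z_def)
    have Tz: "T z = M *\<^sub>v z"
      using Suc.prems z by (intro Suc.IH) (auto simp: z_def)
    have Tu: "T (unit_vec n k) = M *\<^sub>v unit_vec n k"
      using Suc.prems(1) M T[of "unit_vec n k"]
      by (intro eq_vecI) (auto simp: M_def)
    have "T x = T z + x $ k \<cdot>\<^sub>v T (unit_vec n k)"
      using x z add[of z "x $ k \<cdot>\<^sub>v unit_vec n k"] smult[of "unit_vec n k" "x $ k"] by simp
    also have "\<dots> = M *\<^sub>v (z + x $ k \<cdot>\<^sub>v unit_vec n k)"
      using M z by (simp add: Tz Tu mult_add_distrib_mat_vec mult_mat_vec)
    finally show ?case using x by simp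
  qed
  from this[of n] show "T x = M *\<^sub>v x" if "x \<in> carrier_vec n" for x using that by simp
qed

text \<open>The size is an argument because matrices of all sizes share one type, which has no
  common zero; so an empty sum also has a definite size, and identities reduce to sums of
  entries.\<close>

definition mat_sum :: "nat \<Rightarrow> nat \<Rightarrow> ('b \<Rightarrow> 'a :: comm_ring_1 mat) \<Rightarrow> 'b set \<Rightarrow> 'a mat" where
  "mat_sum nr nc F S = mat nr nc (\<lambda>(i, j). \<Sum>a\<in>S. F a $$ (i, j))"

lemma mat_sum_carrier [simp]: "mat_sum nr nc F S \<in> carrier_mat nr nc"
  by (simp add: mat_sum_def)

lemma mat_sum_index: "i < nr \<Longrightarrow> j < nc \<Longrightarrow> mat_sum nr nc F S $$ (i, j) = (\<Sum>a\<in>S. F a $$ (i, j))"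
  by (simp add: mat_sum_def)

lemma mat_sum_cong: "(\<And>a. a \<in> S \<Longrightarrow> F a = H a) \<Longrightarrow> mat_sum nr nc F S = mat_sum nr nc H S"
  by (simp add: mat_sum_def cong: sum.cong)

lemma mat_sum_reindex:
  "bij_betw h S R \<Longrightarrow> mat_sum nr nc F R = mat_sum nr nc (\<lambda>a. F (h a)) S"
  unfolding mat_sum_def by (subst sum.reindex_bij_betw[symmetric, of h S R]) auto

lemma mult_mat_sum_left:
  assumes X: "X \<in> carrier_mat p nr" and F: "\<And>a. a \<in> S \<Longrightarrow> F a \<in> carrier_mat nr nc"
  shows "X * mat_sum nr nc F S = mat_sum p nc (\<lambda>a. X * F a) S"
proof (rule eq_matI)
  fix i j assume "i < dim_row (mat_sum p nc (\<lambda>a. X * F a) S)" "j < dim_col (mat_sum p nc (\<lambda>a. X * F a) S)"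
  then have i: "i < p" and j: "j < nc" by (auto simp: mat_sum_def)
  have "(X * mat_sum nr nc F S) $$ (i, j) = (\<Sum>k<nr. X $$ (i, k) * (\<Sum>a\<in>S. F a $$ (k, j)))"
    using X i j by (simp add: index_mult_mat_sum[OF X mat_sum_carrier] mat_sum_index del: index_mult_mat)
  also have "\<dots> = (\<Sum>a\<in>S. \<Sum>k<nr. X $$ (i, k) * F a $$ (k, j))"
    unfolding sum_distrib_left by (rule sum.swap)
  also have "\<dots> = (\<Sum>a\<in>S. (X * F a) $$ (i, j))"
    using X F i j by (intro sum.cong refl index_mult_mat_sum[symmetric])
  finally show "(X * mat_sum nr nc F S) $$ (i, j) = mat_sum p nc (\<lambda>a. X * F a) S $$ (i, j)"
    using i j by (simp add: mat_sum_index)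
qed (use X in \<open>auto simp: mat_sum_def\<close>)

lemma mult_mat_sum_right:
  assumes X: "X \<in> carrier_mat nc q" and F: "\<And>a. a \<in> S \<Longrightarrow> F a \<in> carrier_mat nr nc"
  shows "mat_sum nr nc F S * X = mat_sum nr q (\<lambda>a. F a * X) S"
proof (rule eq_matI)
  fix i j assume "i < dim_row (mat_sum nr q (\<lambda>a. F a * X) S)" "j < dim_col (mat_sum nr q (\<lambda>a. F a * X) S)"
  then have i: "i < nr" and j: "j < q" by (auto simp: mat_sum_def)
  have "(mat_sum nr nc F S * X) $$ (i, j) = (\<Sum>k<nc. (\<Sum>a\<in>S. F a $$ (i, k)) * X $$ (k, j))"
    using X i j by (simp add: index_mult_mat_sum[OF mat_sum_carrier X] mat_sum_index del: index_mult_mat)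
  also have "\<dots> = (\<Sum>a\<in>S. \<Sum>k<nc. F a $$ (i, k) * X $$ (k, j))"
    unfolding sum_distrib_right by (rule sum.swap)
  also have "\<dots> = (\<Sum>a\<in>S. (F a * X) $$ (i, j))"
    using X F i j by (intro sum.cong refl index_mult_mat_sum[symmetric])
  finally show "(mat_sum nr nc F S * X) $$ (i, j) = mat_sum nr q (\<lambda>a. F a * X) S $$ (i, j)"
    using i j by (simp add: mat_sum_index)
qed (use X in \<open>auto simp: mat_sum_def\<close>)

text \<open>Conditions on dimensions, unlike membership in carrier sets, leave no size to be
  guessed, so long products of rectangular matrices can be normalized by rewriting.\<close>

lemma assoc_mult_mat_dim:
  "dim_col A = dim_row B \<Longrightarrow> dim_col B = dim_row M \<Longrightarrow> A * B * M = A * (B * (M :: 'a :: semiring_0 mat))"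
  by (rule assoc_mult_mat[of A "dim_row A" "dim_row B" B "dim_row M" M "dim_col M"]) (auto intro: carrier_matI)

lemma mult_smult_mat_dim:
  fixes A B :: "'a :: comm_ring_1 mat"
  assumes "dim_col A = dim_row B"
  shows "A * (k \<cdot>\<^sub>m B) = k \<cdot>\<^sub>m (A * B)" "k \<cdot>\<^sub>m A * B = k \<cdot>\<^sub>m (A * B)"
proof -
  have A: "A \<in> carrier_mat (dim_row A) (dim_row B)" using assms by (intro carrier_matI) auto
  have B: "B \<in> carrier_mat (dim_row B) (dim_col B)" by simp
  show "A * (k \<cdot>\<^sub>m B) = k \<cdot>\<^sub>m (A * B)" by (rule mult_smult_distrib[OF A B])
  show "k \<cdot>\<^sub>m A * B = k \<cdot>\<^sub>m (A * B)" by (rule mult_smult_assoc_mat[OF A B])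
qed

lemmas mat_dim_simps = assoc_mult_mat_dim mult_smult_mat_dim

text \<open>\<open>B * D\<close> is a projection onto the column space of \<open>B\<close>, so it
  fixes every matrix whose image lies there. With \<open>L a * B\<close> for \<open>X\<close> this
  expresses invariance of the column space.\<close>

lemma frame_project:
  fixes B D X :: "'a :: comm_ring_1 mat"
  assumes B: "B \<in> carrier_mat n k" and D: "D \<in> carrier_mat k n" and DB: "D * B = 1\<^sub>m k"
    and X: "X \<in> carrier_mat n q"
    and range: "\<And>x. x \<in> carrier_vec q \<Longrightarrow> X *\<^sub>v x \<in> (\<lambda>x. B *\<^sub>v x) ` carrier_vec k"
  shows "B * (D * X) = X"
proof (rule mat_eq_on_vecI[of _ n q])
  fix x :: "'a vec" assume x: "x \<in> carrier_vec q"
  from range[OF x] obtain z where z: "z \<in> carrier_vec k" "X *\<^sub>v x = B *\<^sub>v z" by auto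
  have "B * (D * X) *\<^sub>v x = B *\<^sub>v (D *\<^sub>v (X *\<^sub>v x))"
    using B D X x by (simp add: assoc_mult_mat_vec[of _ n k _ q] assoc_mult_mat_vec[of _ k n _ q])
  also have "\<dots> = B *\<^sub>v (D * B *\<^sub>v z)"
    using assoc_mult_mat_vec[OF D B z(1)] z(2) by simp
  also have "\<dots> = X *\<^sub>v x" using DB z by simp
  finally show "B * (D * X) *\<^sub>v x = X *\<^sub>v x" .
qed (use B D X in auto)

lemma smult_mat_mult_vec:
  assumes "A \<in> carrier_mat p n" "x \<in> carrier_vec n"
  shows "(c \<cdot>\<^sub>m A) *\<^sub>v x = c \<cdot>\<^sub>v (A *\<^sub>v (x :: 'a :: comm_ring_1 vec))"
  using assms by (intro eq_vecI) (auto simp: smult_scalar_prod_distrib[of _ n])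

subsection \<open>Projective representations\<close>

locale twisted_cocycle = group G for G :: "'g monoid" (structure) +
  fixes C :: "'g \<Rightarrow> 'g \<Rightarrow> complex"
  assumes finite_carrier: "finite (carrier G)"
    and C_nonzero: "\<lbrakk>a \<in> carrier G; b \<in> carrier G\<rbrakk> \<Longrightarrow> C a b \<noteq> 0"
    and cocycle: "\<lbrakk>a \<in> carrier G; b \<in> carrier G; c \<in> carrier G\<rbrakk>
      \<Longrightarrow> C a b * C (a \<otimes> b) c = C b c * C a (b \<otimes> c)"
    and C_one_left: "a \<in> carrier G \<Longrightarrow> C \<one> a = 1"
    and C_one_right: "a \<in> carrier G \<Longrightarrow> C a \<one> = 1"
begin

text \<open>The value at the identity has to be prescribed: the zero family satisfies the product
  law as well.\<close>

definition proj_rep :: "nat \<Rightarrow> ('g \<Rightarrow> complex mat) \<Rightarrow> bool" where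
  "proj_rep n \<pi> \<longleftrightarrow> (\<forall>a \<in> carrier G. \<pi> a \<in> carrier_mat n n) \<and>
    (\<forall>a \<in> carrier G. \<forall>b \<in> carrier G. \<pi> a * \<pi> b = C a b \<cdot>\<^sub>m \<pi> (a \<otimes> b)) \<and> \<pi> \<one> = 1\<^sub>m n"

text \<open>The inverse matrix of \<open>\<pi> a\<close>. By the product law
  \<open>\<pi> (inv a) * \<pi> a\<close> is C(a^-1, a) times the identity, and the scalar in front
  corrects this.\<close>

definition rep_inv :: "('g \<Rightarrow> complex mat) \<Rightarrow> 'g \<Rightarrow> complex mat" where
  "rep_inv \<pi> a = inverse (C (inv a) a) \<cdot>\<^sub>m \<pi> (inv a)"

definition irred :: "nat \<Rightarrow> ('g \<Rightarrow> complex mat) \<Rightarrow> bool" where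
  "irred n \<pi> \<longleftrightarrow> proj_rep n \<pi> \<and> 0 < n \<and>
    (\<forall>U. subspace complex_field U (module_vec TYPE(complex) n) \<and>
      (\<forall>a \<in> carrier G. \<forall>x \<in> U. \<pi> a *\<^sub>v x \<in> U) \<longrightarrow> U = {0\<^sub>v n} \<or> U = carrier_vec n)"

definition intertwiner ::
  "nat \<Rightarrow> ('g \<Rightarrow> complex mat) \<Rightarrow> nat \<Rightarrow> ('g \<Rightarrow> complex mat) \<Rightarrow> complex mat \<Rightarrow> bool" where
  "intertwiner n \<pi> p \<sigma> T \<longleftrightarrow> T \<in> carrier_mat p n \<and> (\<forall>a \<in> carrier G. T * \<pi> a = \<sigma> a * T)"

text \<open>Bijectivity on vectors mirrors \<open>representation_isomorphic\<close> and lets the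
  sizes n and p be unrelated.\<close>

definition proj_rep_isomorphic ::
  "nat \<Rightarrow> ('g \<Rightarrow> complex mat) \<Rightarrow> nat \<Rightarrow> ('g \<Rightarrow> complex mat) \<Rightarrow> bool" where
  "proj_rep_isomorphic n \<pi> p \<sigma> \<longleftrightarrow>
    (\<exists>T. intertwiner n \<pi> p \<sigma> T \<and> bij_betw (\<lambda>x. T *\<^sub>v x) (carrier_vec n) (carrier_vec p))"

lemma proj_rep_carrier: "proj_rep n \<pi> \<Longrightarrow> a \<in> carrier G \<Longrightarrow> \<pi> a \<in> carrier_mat n n"
  by (simp add: proj_rep_def)

lemma proj_rep_mult:
  "proj_rep n \<pi> \<Longrightarrow> a \<in> carrier G \<Longrightarrow> b \<in> carrier G \<Longrightarrow> \<pi> a * \<pi> b = C a b \<cdot>\<^sub>m \<pi> (a \<otimes> b)"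
  by (simp add: proj_rep_def)

lemma rep_inv_carrier: "proj_rep n \<pi> \<Longrightarrow> a \<in> carrier G \<Longrightarrow> rep_inv \<pi> a \<in> carrier_mat n n"
  by (simp add: proj_rep_def rep_inv_def)

lemma rep_inv_left:
  assumes "proj_rep n \<pi>" "a \<in> carrier G"
  shows "rep_inv \<pi> a * \<pi> a = 1\<^sub>m n"
proof -
  have "rep_inv \<pi> a * \<pi> a = inverse (C (inv a) a) \<cdot>\<^sub>m (\<pi> (inv a) * \<pi> a)"
    unfolding rep_inv_def using assms
    by (intro mult_smult_assoc_mat[of _ n n _ n]) (simp_all add: proj_rep_carrier)
  also have "\<dots> = 1\<^sub>m n"
    using assms C_nonzero[of "inv a" a]
    by (simp add: proj_rep_def smult_smult_mat) (auto intro: eq_matI)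
  finally show ?thesis .
qed

lemma rep_inv_right:
  assumes "proj_rep n \<pi>" "a \<in> carrier G"
  shows "\<pi> a * rep_inv \<pi> a = 1\<^sub>m n"
  using mat_mult_left_right_inverse[OF rep_inv_carrier[OF assms] proj_rep_carrier[OF assms]]
    rep_inv_left[OF assms] by simp

text \<open>Inverting \<pi>(b) \<pi>(a) = C(b, a) \<pi>(ba) puts the scalar on the other side. In an
  average this scalar is just what turns \<sigma>(ba) into \<sigma>(b) \<sigma>(a).\<close>

lemma rep_inv_shift:
  assumes \<pi>: "proj_rep n \<pi>" and a: "a \<in> carrier G" and b: "b \<in> carrier G"
  shows "rep_inv \<pi> (b \<otimes> a) * \<pi> b = C b a \<cdot>\<^sub>m rep_inv \<pi> a"
proof -
  have ba: "b \<otimes> a \<in> carrier G" using a b by simp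
  note [simp] = proj_rep_carrier[OF \<pi>] rep_inv_carrier[OF \<pi>] a b ba
  have "rep_inv \<pi> (b \<otimes> a) * \<pi> b = rep_inv \<pi> (b \<otimes> a) * (\<pi> b * (\<pi> a * rep_inv \<pi> a))"
    using right_mult_one_mat[of "\<pi> b" n n] by (simp add: rep_inv_right[OF \<pi>])
  also have "\<pi> b * (\<pi> a * rep_inv \<pi> a) = (\<pi> b * \<pi> a) * rep_inv \<pi> a"
    by (rule assoc_mult_mat[symmetric, of _ n n _ n _ n]) simp_all
  also have "\<dots> = C b a \<cdot>\<^sub>m (\<pi> (b \<otimes> a) * rep_inv \<pi> a)"
    by (simp add: proj_rep_mult[OF \<pi>] mult_smult_assoc_mat[of _ n n _ n])
  also have "rep_inv \<pi> (b \<otimes> a) * (C b a \<cdot>\<^sub>m (\<pi> (b \<otimes> a) * rep_inv \<pi> a))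
      = C b a \<cdot>\<^sub>m (rep_inv \<pi> (b \<otimes> a) * (\<pi> (b \<otimes> a) * rep_inv \<pi> a))"
    by (rule mult_smult_distrib[of _ n n _ n]) (auto intro: mult_carrier_mat[of _ n n])
  also have "rep_inv \<pi> (b \<otimes> a) * (\<pi> (b \<otimes> a) * rep_inv \<pi> a)
      = (rep_inv \<pi> (b \<otimes> a) * \<pi> (b \<otimes> a)) * rep_inv \<pi> a"
    by (rule assoc_mult_mat[symmetric, of _ n n _ n _ n]) simp_all
  also have "\<dots> = rep_inv \<pi> a"
    using left_mult_one_mat[of "rep_inv \<pi> a" n n] by (simp add: rep_inv_left[OF \<pi>])
  finally show ?thesis .
qed

lemma bij_betw_left_translation:
  assumes "b \<in> carrier G"
  shows "bij_betw (\<lambda>a. b \<otimes> a) (carrier G) (carrier G)"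
  using assms by (intro bij_betwI[where g = "\<lambda>a. inv b \<otimes> a"]) (auto simp: m_assoc[symmetric])

text \<open>The conjugation average without the division by |G|; hence factors |G| in the
  orthogonality relations and in the semisimplicity argument.\<close>

definition avg ::
  "nat \<Rightarrow> ('g \<Rightarrow> complex mat) \<Rightarrow> nat \<Rightarrow> ('g \<Rightarrow> complex mat) \<Rightarrow> complex mat \<Rightarrow> complex mat" where
  "avg n \<pi> p \<sigma> E = mat_sum p n (\<lambda>a. \<sigma> a * E * rep_inv \<pi> a) (carrier G)"

text \<open>Multiplication by \<pi>(b) on the right is absorbed by the substitution of ba for a; the
  factor C(b, a) from \<open>rep_inv_shift\<close> then splits \<sigma>(ba) into \<sigma>(b)
  \<sigma>(a).\<close>

lemma avg_intertwiner:
  assumes \<pi>: "proj_rep n \<pi>" and \<sigma>: "proj_rep p \<sigma>" and E: "E \<in> carrier_mat p n"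
  shows "intertwiner n \<pi> p \<sigma> (avg n \<pi> p \<sigma> E)"
  unfolding intertwiner_def
proof (intro conjI ballI)
  show "avg n \<pi> p \<sigma> E \<in> carrier_mat p n" by (simp add: avg_def)
  fix b assume b: "b \<in> carrier G"
  note [simp] = proj_rep_carrier[OF \<pi>] rep_inv_carrier[OF \<pi>] proj_rep_carrier[OF \<sigma>] E b
  have summand: "\<sigma> (b \<otimes> a) * E * rep_inv \<pi> (b \<otimes> a) * \<pi> b = \<sigma> b * (\<sigma> a * E * rep_inv \<pi> a)"
    if [simp]: "a \<in> carrier G" for a
  proof -
    have [simp]: "E * rep_inv \<pi> a \<in> carrier_mat p n" by (rule mult_carrier_mat[of _ p n]) simp_all
    have [simp]: "\<sigma> (b \<otimes> a) * E \<in> carrier_mat p n" by (rule mult_carrier_mat[of _ p p]) simp_all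
    have "\<sigma> (b \<otimes> a) * E * rep_inv \<pi> (b \<otimes> a) * \<pi> b = \<sigma> (b \<otimes> a) * E * (rep_inv \<pi> (b \<otimes> a) * \<pi> b)"
      by (rule assoc_mult_mat[of _ p n _ n _ n]) simp_all
    also have "\<dots> = C b a \<cdot>\<^sub>m (\<sigma> (b \<otimes> a) * E * rep_inv \<pi> a)"
      unfolding rep_inv_shift[OF \<pi> that b] by (rule mult_smult_distrib[of _ p n _ n]) simp_all
    also have "\<sigma> (b \<otimes> a) * E * rep_inv \<pi> a = \<sigma> (b \<otimes> a) * (E * rep_inv \<pi> a)"
      by (rule assoc_mult_mat[of _ p p _ n _ n]) simp_all
    also have "C b a \<cdot>\<^sub>m (\<sigma> (b \<otimes> a) * (E * rep_inv \<pi> a)) = (C b a \<cdot>\<^sub>m \<sigma> (b \<otimes> a)) * (E * rep_inv \<pi> a)"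
      by (rule mult_smult_assoc_mat[symmetric, of _ p p _ n]) simp_all
    also have "\<dots> = \<sigma> b * \<sigma> a * (E * rep_inv \<pi> a)"
      by (simp add: proj_rep_mult[OF \<sigma>])
    also have "\<dots> = \<sigma> b * (\<sigma> a * (E * rep_inv \<pi> a))"
      by (rule assoc_mult_mat[of _ p p _ p _ n]) simp_all
    also have "\<sigma> a * (E * rep_inv \<pi> a) = \<sigma> a * E * rep_inv \<pi> a"
      by (rule assoc_mult_mat[symmetric, of _ p p _ n _ n]) simp_all
    finally show ?thesis .
  qed
  have [simp]: "\<sigma> a * E * rep_inv \<pi> a \<in> carrier_mat p n" if "a \<in> carrier G" for a
    using that by (intro mult_carrier_mat[of _ p n _ n] mult_carrier_mat[of _ p p _ n]) simp_all
  have "avg n \<pi> p \<sigma> E * \<pi> b = mat_sum p n (\<lambda>a. \<sigma> a * E * rep_inv \<pi> a * \<pi> b) (carrier G)"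
    unfolding avg_def by (rule mult_mat_sum_right) simp_all
  also have "\<dots> = mat_sum p n (\<lambda>a. \<sigma> (b \<otimes> a) * E * rep_inv \<pi> (b \<otimes> a) * \<pi> b) (carrier G)"
    by (rule mat_sum_reindex[OF bij_betw_left_translation[OF b]])
  also have "\<dots> = mat_sum p n (\<lambda>a. \<sigma> b * (\<sigma> a * E * rep_inv \<pi> a)) (carrier G)"
    by (intro mat_sum_cong summand)
  also have "\<dots> = \<sigma> b * avg n \<pi> p \<sigma> E"
    unfolding avg_def by (rule mult_mat_sum_left[symmetric]) simp_all
  finally show "avg n \<pi> p \<sigma> E * \<pi> b = \<sigma> b * avg n \<pi> p \<sigma> E" .
qed

lemma irred_invariant:
  assumes "irred n \<pi>" "subspace complex_field U (module_vec TYPE(complex) n)"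
    "\<And>a x. a \<in> carrier G \<Longrightarrow> x \<in> U \<Longrightarrow> \<pi> a *\<^sub>v x \<in> U" "x \<in> U" "x \<noteq> 0\<^sub>v n"
  shows "U = carrier_vec n"
  using assms unfolding irred_def by blast

subsection \<open>Schur orthogonality\<close>

text \<open>The kernel of \<open>T\<close> is invariant and not everything, the range is invariant
  and not zero; irreducibility on both sides leaves only a bijection.\<close>

lemma schur_isomorphic:
  assumes \<pi>: "irred n \<pi>" and \<sigma>: "irred p \<sigma>" and T: "intertwiner n \<pi> p \<sigma> T" and "T \<noteq> 0\<^sub>m p n"
  shows "proj_rep_isomorphic n \<pi> p \<sigma>"
proof -
  have rep\<pi>: "proj_rep n \<pi>" and rep\<sigma>: "proj_rep p \<sigma>" using \<pi> \<sigma> by (auto simp: irred_def)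
  have Tc: "T \<in> carrier_mat p n" and comm: "\<And>a. a \<in> carrier G \<Longrightarrow> T * \<pi> a = \<sigma> a * T"
    using T by (auto simp: intertwiner_def)
  have Tv: "T *\<^sub>v x \<in> carrier_vec p" if "x \<in> carrier_vec n" for x
    using Tc that by simp
  have commv: "T *\<^sub>v (\<pi> a *\<^sub>v x) = \<sigma> a *\<^sub>v (T *\<^sub>v x)" if "a \<in> carrier G" "x \<in> carrier_vec n" for a x
    using assoc_mult_mat_vec[OF Tc proj_rep_carrier[OF rep\<pi> that(1)] that(2)]
      assoc_mult_mat_vec[OF proj_rep_carrier[OF rep\<sigma> that(1)] Tc that(2)] comm[OF that(1)] by simp
  have T0: "T *\<^sub>v 0\<^sub>v n = 0\<^sub>v p" using Tc by (auto intro!: eq_vecI)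
  have nonzero: "\<exists>x \<in> carrier_vec n. T *\<^sub>v x \<noteq> 0\<^sub>v p"
  proof (rule ccontr)
    assume "\<not> ?thesis"
    then have "T = 0\<^sub>m p n" using Tc by (intro mat_eq_on_vecI) auto
    with \<open>T \<noteq> 0\<^sub>m p n\<close> show False by simp
  qed
  define K where "K = {x \<in> carrier_vec n. T *\<^sub>v x = 0\<^sub>v p}"
  have "subspace complex_field K (module_vec TYPE(complex) n)"
    unfolding subspace_module_vec_iff K_def
    using Tc T0 by (auto simp: mult_add_distrib_mat_vec mult_mat_vec)
  moreover have "\<pi> a *\<^sub>v x \<in> K" if "a \<in> carrier G" "x \<in> K" for a x
    using that commv[of a x] proj_rep_carrier[OF rep\<sigma> that(1)] proj_rep_carrier[OF rep\<pi> that(1)]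
    by (auto simp: K_def intro!: eq_vecI)
  moreover have "K \<noteq> carrier_vec n" using nonzero by (auto simp: K_def)
  ultimately have "K = {0\<^sub>v n}" using \<pi> unfolding irred_def by blast
  then have ker: "x = 0\<^sub>v n" if "x \<in> carrier_vec n" "T *\<^sub>v x = 0\<^sub>v p" for x
    using that by (auto simp: K_def)
  define R where "R = (\<lambda>x. T *\<^sub>v x) ` carrier_vec n"
  have "subspace complex_field R (module_vec TYPE(complex) p)"
    unfolding subspace_module_vec_iff R_def
  proof (intro conjI ballI allI)
    show "0\<^sub>v p \<in> (\<lambda>x. T *\<^sub>v x) ` carrier_vec n" using T0 by (metis imageI zero_carrier_vec)
  next
    fix x y assume "x \<in> (\<lambda>x. T *\<^sub>v x) ` carrier_vec n" "y \<in> (\<lambda>x. T *\<^sub>v x) ` carrier_vec n"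
    then show "x + y \<in> (\<lambda>x. T *\<^sub>v x) ` carrier_vec n"
      using Tc by (auto simp: mult_add_distrib_mat_vec[symmetric])
  next
    fix c x assume "x \<in> (\<lambda>x. T *\<^sub>v x) ` carrier_vec n"
    then show "c \<cdot>\<^sub>v x \<in> (\<lambda>x. T *\<^sub>v x) ` carrier_vec n"
      using Tc by (auto simp: mult_mat_vec[symmetric])
  qed (use Tv in auto)
  moreover have "\<sigma> a *\<^sub>v x \<in> R" if "a \<in> carrier G" "x \<in> R" for a x
    using that commv[of a] proj_rep_carrier[OF rep\<pi> that(1)]
    by (auto simp: R_def simp flip: commv)
  moreover have "R \<noteq> {0\<^sub>v p}" using nonzero by (auto simp: R_def)
  ultimately have R: "R = carrier_vec p" using \<sigma> unfolding irred_def by blast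
  have "inj_on (\<lambda>x. T *\<^sub>v x) (carrier_vec n)"
  proof (rule inj_onI)
    fix x y assume x: "x \<in> carrier_vec n" and y: "y \<in> carrier_vec n" and eq: "T *\<^sub>v x = T *\<^sub>v y"
    have "T *\<^sub>v (x - y) = 0\<^sub>v p"
      using mult_minus_distrib_mat_vec[OF Tc x y] eq Tv[OF y] by simp
    then have "x - y = 0\<^sub>v n" using ker[of "x - y"] x y by simp
    show "x = y"
    proof (rule eq_vecI)
      fix i assume "i < dim_vec y"
      then have "i < n" using y by simp
      then have "(x - y) $ i = 0" using \<open>x - y = 0\<^sub>v n\<close> by simp
      then show "x $ i = y $ i" using \<open>i < n\<close> x y by simp
    qed (use x y in simp)
  qed
  then have "bij_betw (\<lambda>x. T *\<^sub>v x) (carrier_vec n) (carrier_vec p)"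
    using R by (simp add: bij_betw_def R_def)
  then show ?thesis using T by (auto simp: proj_rep_isomorphic_def)
qed

text \<open>An eigenspace of \<open>T\<close> is invariant because \<open>T\<close> commutes with
  all \<open>\<pi> a\<close>. Being nonzero, it is the whole space.\<close>

lemma schur_scalar:
  assumes \<pi>: "irred n \<pi>" and T: "intertwiner n \<pi> n \<pi> T"
  obtains c where "T = c \<cdot>\<^sub>m 1\<^sub>m n"
proof -
  have rep\<pi>: "proj_rep n \<pi>" and n: "0 < n" using \<pi> by (auto simp: irred_def)
  have Tc: "T \<in> carrier_mat n n" and comm: "\<And>a. a \<in> carrier G \<Longrightarrow> T * \<pi> a = \<pi> a * T"
    using T by (auto simp: intertwiner_def)
  have commv: "T *\<^sub>v (\<pi> a *\<^sub>v x) = \<pi> a *\<^sub>v (T *\<^sub>v x)" if "a \<in> carrier G" "x \<in> carrier_vec n" for a x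
    using assoc_mult_mat_vec[OF Tc proj_rep_carrier[OF rep\<pi> that(1)] that(2)]
      assoc_mult_mat_vec[OF proj_rep_carrier[OF rep\<pi> that(1)] Tc that(2)] comm[OF that(1)] by simp
  obtain c x where x: "x \<in> carrier_vec n" "x \<noteq> 0\<^sub>v n" "T *\<^sub>v x = c \<cdot>\<^sub>v x"
    using exists_eigenvector[OF Tc n] .
  define K where "K = {x \<in> carrier_vec n. T *\<^sub>v x = c \<cdot>\<^sub>v x}"
  have "T *\<^sub>v 0\<^sub>v n = 0\<^sub>v n" using Tc by (auto intro!: eq_vecI)
  then have "subspace complex_field K (module_vec TYPE(complex) n)"
    unfolding subspace_module_vec_iff K_def
    using Tc by (auto simp: mult_add_distrib_mat_vec mult_mat_vec smult_add_distrib_vec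
      smult_smult_assoc mult.commute)
  moreover have "\<pi> a *\<^sub>v x \<in> K" if "a \<in> carrier G" "x \<in> K" for a x
    using that proj_rep_carrier[OF rep\<pi> that(1)] by (auto simp: K_def commv mult_mat_vec)
  ultimately have "K = carrier_vec n"
    using x by (intro irred_invariant[OF \<pi>, of K x]) (auto simp: K_def)
  then have "T *\<^sub>v x = c \<cdot>\<^sub>v x" if "x \<in> carrier_vec n" for x
    using that by (auto simp: K_def)
  then have "T = c \<cdot>\<^sub>m 1\<^sub>m n"
    using Tc by (intro mat_eq_on_vecI[of _ n n]) (auto simp: K_def smult_mat_mult_vec[of _ n n])
  then show ?thesis by (rule that)
qed

text \<open>Averaging the matrix unit at position (q, k) singles out one product of matrix entries
  per group element. So statements about intertwiners become orthogonality relations.\<close>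

lemma avg_unit_entry:
  assumes \<pi>: "proj_rep n \<pi>" and \<sigma>: "proj_rep p \<sigma>" and r: "r < p" "q < p" "k < n" "l < n"
  shows "avg n \<pi> p \<sigma> (mat p n (\<lambda>(i, j). if i = q \<and> j = k then 1 else 0)) $$ (r, l)
    = (\<Sum>a\<in>carrier G. \<sigma> a $$ (r, q) * rep_inv \<pi> a $$ (k, l))"
proof -
  define E where "E = mat p n (\<lambda>(i, j). if i = q \<and> j = k then 1 else (0 :: complex))"
  have E: "E \<in> carrier_mat p n" by (simp add: E_def)
  have "(\<sigma> a * E * rep_inv \<pi> a) $$ (r, l) = \<sigma> a $$ (r, q) * rep_inv \<pi> a $$ (k, l)"
    if a: "a \<in> carrier G" for a
  proof -
    have \<sigma>E: "\<sigma> a * E \<in> carrier_mat p n" using proj_rep_carrier[OF \<sigma> a] E by simp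
    have ent: "(\<sigma> a * E) $$ (r, j) = (if j = k then \<sigma> a $$ (r, q) else 0)" if "j < n" for j
    proof -
      have "(\<sigma> a * E) $$ (r, j) = (\<Sum>i<p. \<sigma> a $$ (r, i) * E $$ (i, j))"
        using proj_rep_carrier[OF \<sigma> a] E r(1) that by (rule index_mult_mat_sum)
      also have "\<dots> = (\<Sum>i<p. if i = q then (if j = k then \<sigma> a $$ (r, q) else 0) else 0)"
        using that by (intro sum.cong) (auto simp: E_def)
      also have "\<dots> = (if j = k then \<sigma> a $$ (r, q) else 0)"
        using r by simp
      finally show ?thesis .
    qed
    have "(\<sigma> a * E * rep_inv \<pi> a) $$ (r, l) = (\<Sum>j<n. (\<sigma> a * E) $$ (r, j) * rep_inv \<pi> a $$ (j, l))"
      using \<sigma>E rep_inv_carrier[OF \<pi> a] r(1,4) by (rule index_mult_mat_sum)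
    also have "\<dots> = (\<Sum>j<n. if j = k then \<sigma> a $$ (r, q) * rep_inv \<pi> a $$ (k, l) else 0)"
      by (intro sum.cong) (auto simp: ent)
    finally show ?thesis using r by simp
  qed
  then show ?thesis
    using r unfolding avg_def E_def[symmetric] by (simp add: mat_sum_index)
qed

text \<open>The averaged matrix unit is an intertwiner, and by Schur's lemma a nonzero one would be
  an isomorphism.\<close>

lemma orthogonality_distinct:
  assumes \<pi>: "irred n \<pi>" and \<sigma>: "irred p \<sigma>" and "\<not> proj_rep_isomorphic n \<pi> p \<sigma>"
    and r: "r < p" "q < p" "k < n" "l < n"
  shows "(\<Sum>a\<in>carrier G. \<sigma> a $$ (r, q) * rep_inv \<pi> a $$ (k, l)) = 0"
proof -
  have rep: "proj_rep n \<pi>" "proj_rep p \<sigma>" using \<pi> \<sigma> by (auto simp: irred_def)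
  let ?E = "mat p n (\<lambda>(i, j). if i = q \<and> j = k then 1 else (0 :: complex))"
  have "intertwiner n \<pi> p \<sigma> (avg n \<pi> p \<sigma> ?E)" by (rule avg_intertwiner[OF rep]) simp
  then have "avg n \<pi> p \<sigma> ?E = 0\<^sub>m p n"
    using schur_isomorphic[OF \<pi> \<sigma>] assms(3) by blast
  then show ?thesis using avg_unit_entry[OF rep r] r by simp
qed

lemma orthogonality_same:
  assumes \<pi>: "irred n \<pi>" and r: "r < n" "q < n" "k < n" "l < n"
  shows "(\<Sum>a\<in>carrier G. \<pi> a $$ (r, q) * rep_inv \<pi> a $$ (k, l))
    = (if r = l \<and> q = k then of_nat (card (carrier G)) / of_nat n else 0)"
proof -
  have rep: "proj_rep n \<pi>" using \<pi> by (auto simp: irred_def)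
  let ?E = "mat n n (\<lambda>(i, j). if i = q \<and> j = k then 1 else (0 :: complex))"
  let ?S = "\<lambda>r l. \<Sum>a\<in>carrier G. \<pi> a $$ (r, q) * rep_inv \<pi> a $$ (k, l)"
  have "intertwiner n \<pi> n \<pi> (avg n \<pi> n \<pi> ?E)" by (rule avg_intertwiner[OF rep rep]) simp
  then obtain c where c: "avg n \<pi> n \<pi> ?E = c \<cdot>\<^sub>m 1\<^sub>m n" using schur_scalar[OF \<pi>] by blast
  have S: "?S r l = (if r = l then c else 0)" if "r < n" "l < n" for r l
    using that by (subst avg_unit_entry[OF rep rep that(1) r(2,3) that(2), symmetric]) (simp add: c)
  \<comment> \<open>The scalar is found from the trace: summing the diagonal entries reassembles
    \<open>rep_inv \<pi> a * \<pi> a\<close>, the identity matrix, for each of the |G|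
    elements.\<close>
  have "of_nat n * c = (\<Sum>j<n. ?S j j)" by (simp add: S)
  also have "\<dots> = (\<Sum>a\<in>carrier G. \<Sum>j<n. rep_inv \<pi> a $$ (k, j) * \<pi> a $$ (j, q))"
    by (subst sum.swap) (simp add: mult.commute)
  also have "\<dots> = (\<Sum>a\<in>carrier G. (rep_inv \<pi> a * \<pi> a) $$ (k, q))"
    using rep_inv_carrier[OF rep] proj_rep_carrier[OF rep] r
    by (intro sum.cong refl index_mult_mat_sum[symmetric])
  also have "\<dots> = (if q = k then of_nat (card (carrier G)) else 0)"
    using r by (simp add: rep_inv_left[OF rep])
  finally have "of_nat n * c = (if q = k then of_nat (card (carrier G)) else 0)" .
  then have "c = (if q = k then of_nat (card (carrier G)) / of_nat n else 0)"
    using r by (auto simp: field_simps split: if_splits)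
  then show ?thesis using S[OF r(1,4)] by simp
qed

subsection \<open>Semisimplicity\<close>

text \<open>An invariant frame inside K of least positive size is irreducible: a frame of an
  invariant subspace of its coordinate space composes with it to another invariant frame, so by
  minimality that subspace is zero or everything.\<close>

lemma exists_irred_subrep:
  assumes L: "proj_rep N L" and K: "subspace complex_field K (module_vec TYPE(complex) N)"
    and inv: "\<And>a x. a \<in> carrier G \<Longrightarrow> x \<in> K \<Longrightarrow> L a *\<^sub>v x \<in> K" and "K \<noteq> {0\<^sub>v N}"
  obtains k B D where "B \<in> carrier_mat N k" "D \<in> carrier_mat k N" "D * B = 1\<^sub>m k"
    "\<And>x. x \<in> carrier_vec k \<Longrightarrow> B *\<^sub>v x \<in> K"
    "\<And>a. a \<in> carrier G \<Longrightarrow> B * (D * (L a * B)) = L a * B"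
    "irred k (\<lambda>a. D * (L a * B))"
proof -
  define Q where "Q k \<longleftrightarrow> 0 < k \<and> (\<exists>B D. B \<in> carrier_mat N k \<and> D \<in> carrier_mat k N \<and> D * B = 1\<^sub>m k \<and>
    (\<forall>x \<in> carrier_vec k. B *\<^sub>v x \<in> K) \<and> (\<forall>a \<in> carrier G. B * (D * (L a * B)) = L a * B))" for k
  have Lc: "L a \<in> carrier_mat N N" if "a \<in> carrier G" for a using proj_rep_carrier[OF L that] .
  obtain k0 B0 D0 where B0: "B0 \<in> carrier_mat N k0" and D0: "D0 \<in> carrier_mat k0 N"
    and DB0: "D0 * B0 = 1\<^sub>m k0" and KB0: "K = (\<lambda>x. B0 *\<^sub>v x) ` carrier_vec k0"
    using subspace_frame[OF K] .
  have "K = {0\<^sub>v N}" if "k0 = 0"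
  proof -
    have "x = 0\<^sub>v N" if "x \<in> K" for x
      using that \<open>k0 = 0\<close> B0 unfolding KB0 by (auto intro!: eq_vecI simp: scalar_prod_def)
    then show ?thesis using K by (auto simp: subspace_module_vec_iff)
  qed
  then have "0 < k0" using \<open>K \<noteq> {0\<^sub>v N}\<close> by auto
  moreover have "B0 * (D0 * (L a * B0)) = L a * B0" if a: "a \<in> carrier G" for a
  proof (rule frame_project[OF B0 D0 DB0])
    show "L a * B0 \<in> carrier_mat N k0" using Lc[OF a] B0 by simp
    fix x :: "complex vec" assume x: "x \<in> carrier_vec k0"
    then have "L a *\<^sub>v (B0 *\<^sub>v x) \<in> K" using inv[OF a] KB0 by auto
    then show "L a * B0 *\<^sub>v x \<in> (\<lambda>x. B0 *\<^sub>v x) ` carrier_vec k0"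
      using assoc_mult_mat_vec[OF Lc[OF a] B0 x] KB0 by simp
  qed
  moreover have "\<forall>x \<in> carrier_vec k0. B0 *\<^sub>v x \<in> K" using KB0 by auto
  ultimately have "Q k0" unfolding Q_def using B0 D0 DB0 by blast
  define k where "k = (LEAST k. Q k)"
  have Qk: "Q k" and least: "\<And>l. Q l \<Longrightarrow> k \<le> l"
    using \<open>Q k0\<close> by (auto simp: k_def intro: LeastI Least_le)
  from Qk obtain B D where k: "0 < k" and B: "B \<in> carrier_mat N k" and D: "D \<in> carrier_mat k N"
    and DB: "D * B = 1\<^sub>m k" and BK: "\<And>x. x \<in> carrier_vec k \<Longrightarrow> B *\<^sub>v x \<in> K"
    and inv_B: "\<And>a. a \<in> carrier G \<Longrightarrow> B * (D * (L a * B)) = L a * B"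
    unfolding Q_def by auto
  \<comment> \<open>The restriction of \<open>L a\<close> to the column space, written in the basis
    of columns of \<open>B\<close>.\<close>
  let ?\<pi> = "\<lambda>a. D * (L a * B)"
  have \<pi>c: "?\<pi> a \<in> carrier_mat k k" if "a \<in> carrier G" for a
    using Lc[OF that] B D by simp
  have rep: "proj_rep k ?\<pi>"
    unfolding proj_rep_def
  proof (intro conjI ballI)
    fix a b assume a: "a \<in> carrier G" and b: "b \<in> carrier G"
    then have ab: "a \<otimes> b \<in> carrier G" by simp
    note [simp] = Lc[OF a, THEN carrier_matD(1)] Lc[OF a, THEN carrier_matD(2)]
      Lc[OF b, THEN carrier_matD(1)] Lc[OF b, THEN carrier_matD(2)]
      Lc[OF ab, THEN carrier_matD(1)] Lc[OF ab, THEN carrier_matD(2)]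
      carrier_matD[OF B] carrier_matD[OF D]
    have "?\<pi> a * ?\<pi> b = D * (L a * (B * (D * (L b * B))))"
      by (simp add: mat_dim_simps)
    also have "\<dots> = D * (L a * L b * B)"
      unfolding inv_B[OF b] by (simp add: mat_dim_simps)
    also have "\<dots> = C a b \<cdot>\<^sub>m ?\<pi> (a \<otimes> b)"
      unfolding proj_rep_mult[OF L a b] by (simp add: mat_dim_simps)
    finally show "?\<pi> a * ?\<pi> b = C a b \<cdot>\<^sub>m ?\<pi> (a \<otimes> b)" .
  next
    have "L \<one> = 1\<^sub>m N" using L by (simp add: proj_rep_def)
    then show "?\<pi> \<one> = 1\<^sub>m k" using B DB by simp
  qed (use \<pi>c in simp)
  moreover have "U = {0\<^sub>v k} \<or> U = carrier_vec k"
    if U: "subspace complex_field U (module_vec TYPE(complex) k)"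
      and U_inv: "\<And>a x. a \<in> carrier G \<Longrightarrow> x \<in> U \<Longrightarrow> ?\<pi> a *\<^sub>v x \<in> U" for U
  proof -
    obtain k' B' D' where B': "B' \<in> carrier_mat k k'" and D': "D' \<in> carrier_mat k' k"
      and DB': "D' * B' = 1\<^sub>m k'" and UB': "U = (\<lambda>x. B' *\<^sub>v x) ` carrier_vec k'"
      using subspace_frame[OF U] .
    show ?thesis
    proof (cases "k' = 0")
      case True
      have "x = 0\<^sub>v k" if "x \<in> U" for x
        using that True B' unfolding UB' by (auto intro!: eq_vecI simp: scalar_prod_def)
      then show ?thesis using U by (auto simp: subspace_module_vec_iff)
    next
      case False
      note [simp] = carrier_matD[OF B] carrier_matD[OF D] carrier_matD[OF B'] carrier_matD[OF D']
      \<comment> \<open>\<open>B * B'\<close> with left inverse \<open>D' * D\<close> is the frame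
        of the image of \<open>U\<close> in the large space; minimality of k applies to it.\<close>
      have "D' * D * (B * B') = D' * ((D * B) * B')" by (simp add: mat_dim_simps)
      also have "\<dots> = 1\<^sub>m k'" using B' DB' by (simp add: DB)
      finally have "D' * D * (B * B') = 1\<^sub>m k'" .
      moreover have "B * B' *\<^sub>v x \<in> K" if "x \<in> carrier_vec k'" for x
        using assoc_mult_mat_vec[OF B B' that] BK B' that by simp
      moreover have "B * B' * (D' * D * (L a * (B * B'))) = L a * (B * B')" if a: "a \<in> carrier G" for a
      proof -
        note [simp] = carrier_matD[OF Lc[OF a]]
        have eq: "B' * (D' * (?\<pi> a * B')) = ?\<pi> a * B'"
        proof (rule frame_project[OF B' D' DB'])
          show "?\<pi> a * B' \<in> carrier_mat k k'" using \<pi>c[OF a] B' by simp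
          fix x :: "complex vec" assume x: "x \<in> carrier_vec k'"
          then have "?\<pi> a *\<^sub>v (B' *\<^sub>v x) \<in> U" using U_inv[OF a] UB' by auto
          then show "?\<pi> a * B' *\<^sub>v x \<in> (\<lambda>x. B' *\<^sub>v x) ` carrier_vec k'"
            using assoc_mult_mat_vec[OF \<pi>c[OF a] B' x] UB' by simp
        qed
        have "B * B' * (D' * D * (L a * (B * B'))) = B * (B' * (D' * (?\<pi> a * B')))"
          by (simp add: mat_dim_simps)
        also have "\<dots> = B * ?\<pi> a * B'"
          unfolding eq by (simp add: mat_dim_simps)
        also have "\<dots> = L a * (B * B')"
          unfolding inv_B[OF a] by (simp add: mat_dim_simps)
        finally show ?thesis .
      qed
      moreover have "B * B' \<in> carrier_mat N k'" "D' * D \<in> carrier_mat k' N" using B B' D D' by auto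
      ultimately have "Q k'" unfolding Q_def using False by blast
      then have "k' = k"
        using least left_inverse_dim_le[OF B' D' DB'] by (auto intro: antisym)
      have "x \<in> U" if x: "x \<in> carrier_vec k" for x
      proof -
        \<comment> \<open>With k' = k the frame of \<open>U\<close> is square, so its left inverse
          is two-sided and every vector is a combination of its columns.\<close>
        have "B' * D' = 1\<^sub>m k"
          using mat_mult_left_right_inverse[of D' k B'] B' D' DB' \<open>k' = k\<close> by simp
        then have "B' *\<^sub>v (D' *\<^sub>v x) = x"
          using assoc_mult_mat_vec[OF B' D' x] x by simp
        moreover have "D' *\<^sub>v x \<in> carrier_vec k'" using D' x by simp
        ultimately show ?thesis unfolding UB' by (metis imageI)
      qed
      then show ?thesis using U by (auto simp: subspace_module_vec_iff)
    qed
  qed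
  ultimately have "irred k ?\<pi>" using k by (auto simp: irred_def)
  then show ?thesis using that[OF B D DB BK inv_B] by blast
qed

section \<open>Linear extension of a projective representation to coefficient functions\<close>

definition rep_eval :: "nat \<Rightarrow> ('g \<Rightarrow> complex mat) \<Rightarrow> ('g \<Rightarrow> complex) \<Rightarrow> complex mat" where
  "rep_eval n \<pi> f = mat_sum n n (\<lambda>a. f a \<cdot>\<^sub>m \<pi> a) (carrier G)"

lemma rep_eval_carrier [simp]: "rep_eval n \<pi> f \<in> carrier_mat n n"
  by (simp add: rep_eval_def)

lemma rep_eval_index:
  assumes "proj_rep n \<pi>" "i < n" "j < n"
  shows "rep_eval n \<pi> f $$ (i, j) = (\<Sum>a\<in>carrier G. f a * \<pi> a $$ (i, j))"
  using assms proj_rep_carrier[OF assms(1), THEN carrier_matD(1)]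
    proj_rep_carrier[OF assms(1), THEN carrier_matD(2)]
  by (simp add: rep_eval_def mat_sum_index)

lemma mult_rep_eval_left:
  assumes \<pi>: "proj_rep n \<pi>" and X: "X \<in> carrier_mat p n"
  shows "X * rep_eval n \<pi> f = mat_sum p n (\<lambda>a. f a \<cdot>\<^sub>m (X * \<pi> a)) (carrier G)"
proof -
  note [simp] = carrier_matD[OF X] proj_rep_carrier[OF \<pi>, THEN carrier_matD(1)]
  have "X * rep_eval n \<pi> f = mat_sum p n (\<lambda>a. X * (f a \<cdot>\<^sub>m \<pi> a)) (carrier G)"
    unfolding rep_eval_def using X proj_rep_carrier[OF \<pi>] by (intro mult_mat_sum_left) auto
  also have "\<dots> = mat_sum p n (\<lambda>a. f a \<cdot>\<^sub>m (X * \<pi> a)) (carrier G)"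
    by (intro mat_sum_cong) (simp add: mat_dim_simps)
  finally show ?thesis .
qed

lemma mult_rep_eval_right:
  assumes \<pi>: "proj_rep n \<pi>" and X: "X \<in> carrier_mat n p"
  shows "rep_eval n \<pi> f * X = mat_sum n p (\<lambda>a. f a \<cdot>\<^sub>m (\<pi> a * X)) (carrier G)"
proof -
  note [simp] = carrier_matD[OF X] proj_rep_carrier[OF \<pi>, THEN carrier_matD(2)]
  have "rep_eval n \<pi> f * X = mat_sum n p (\<lambda>a. f a \<cdot>\<^sub>m \<pi> a * X) (carrier G)"
    unfolding rep_eval_def using X proj_rep_carrier[OF \<pi>] by (intro mult_mat_sum_right) auto
  also have "\<dots> = mat_sum n p (\<lambda>a. f a \<cdot>\<^sub>m (\<pi> a * X)) (carrier G)"
    by (intro mat_sum_cong) (simp add: mat_dim_simps)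
  finally show ?thesis .
qed

lemma intertwiner_rep_eval:
  assumes \<pi>: "proj_rep n \<pi>" and \<sigma>: "proj_rep p \<sigma>" and T: "intertwiner n \<pi> p \<sigma> T"
  shows "T * rep_eval n \<pi> f = rep_eval p \<sigma> f * T"
proof -
  have Tc: "T \<in> carrier_mat p n" using T by (simp add: intertwiner_def)
  show ?thesis
    unfolding mult_rep_eval_left[OF \<pi> Tc] mult_rep_eval_right[OF \<sigma> Tc]
    using T by (intro mat_sum_cong) (simp add: intertwiner_def)
qed

text \<open>An intertwiner also commutes with the linear extensions, and the injective
  \<open>T\<close> can be cancelled. Thus the kernel on W depends only on the isomorphism
  class.\<close>

lemma rep_eval_isomorphic_zero:
  assumes \<pi>: "proj_rep n \<pi>" and \<sigma>: "proj_rep p \<sigma>" and iso: "proj_rep_isomorphic n \<pi> p \<sigma>"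
    and zero: "rep_eval p \<sigma> f = 0\<^sub>m p p"
  shows "rep_eval n \<pi> f = 0\<^sub>m n n"
proof -
  from iso obtain T where T: "intertwiner n \<pi> p \<sigma> T"
    and bij: "bij_betw (\<lambda>x. T *\<^sub>v x) (carrier_vec n) (carrier_vec p)"
    by (auto simp: proj_rep_isomorphic_def)
  have Tc: "T \<in> carrier_mat p n" using T by (simp add: intertwiner_def)
  have *: "T * rep_eval n \<pi> f = 0\<^sub>m p n"
    using intertwiner_rep_eval[OF \<pi> \<sigma> T] zero Tc by simp
  show ?thesis
  proof (rule mat_eq_on_vecI[of _ n n])
    fix x :: "complex vec" assume x: "x \<in> carrier_vec n"
    have Rx: "rep_eval n \<pi> f *\<^sub>v x \<in> carrier_vec n" by (rule mult_mat_vec_carrier[OF rep_eval_carrier x])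
    have "T *\<^sub>v (rep_eval n \<pi> f *\<^sub>v x) = 0\<^sub>m p n *\<^sub>v x"
      using assoc_mult_mat_vec[OF Tc rep_eval_carrier x, of \<pi> f] * by simp
    also have "\<dots> = T *\<^sub>v 0\<^sub>v n"
      using Tc x by (auto intro!: eq_vecI)
    finally have "T *\<^sub>v (rep_eval n \<pi> f *\<^sub>v x) = T *\<^sub>v 0\<^sub>v n" .
    then have "rep_eval n \<pi> f *\<^sub>v x = 0\<^sub>v n"
      using bij Rx by (auto simp: bij_betw_def dest!: inj_onD)
    then show "rep_eval n \<pi> f *\<^sub>v x = 0\<^sub>m n n *\<^sub>v x" using x by auto
  qed simp_all
qed

lemma rep_eval_cong:
  "(\<And>a. a \<in> carrier G \<Longrightarrow> f a = g a) \<Longrightarrow> rep_eval n \<pi> f = rep_eval n \<pi> g"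
  unfolding rep_eval_def by (intro mat_sum_cong) simp

lemma rep_eval_add:
  assumes "proj_rep n \<pi>"
  shows "rep_eval n \<pi> (\<lambda>a. f a + g a) = rep_eval n \<pi> f + rep_eval n \<pi> g"
  by (rule eq_matI) (simp_all add: rep_eval_index[OF assms] sum.distrib algebra_simps
    carrier_matD[OF rep_eval_carrier])

lemma rep_eval_smult:
  assumes "proj_rep n \<pi>"
  shows "rep_eval n \<pi> (\<lambda>a. c * f a) = c \<cdot>\<^sub>m rep_eval n \<pi> f"
  by (rule eq_matI) (simp_all add: rep_eval_index[OF assms] sum_distrib_left mult.assoc
    carrier_matD[OF rep_eval_carrier])

section \<open>The regular representation and the joint kernel\<close>

abbreviation N :: nat where "N \<equiv> card (carrier G)"

definition enum :: "nat \<Rightarrow> 'g" where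
  "enum = (SOME e. bij_betw e {..<N} (carrier G))"

definition idx :: "'g \<Rightarrow> nat" where
  "idx = inv_into {..<N} enum"

text \<open>Left multiplication by v_a on W in the basis v, numbered by \<open>enum\<close>: column
  j carries C(a, b) in the row of ab, where b is \<open>enum j\<close>.\<close>

definition regular :: "'g \<Rightarrow> complex mat" where
  "regular a = mat N N (\<lambda>(i, j). if a \<otimes> enum j = enum i then C a (enum j) else 0)"

lemma bij_enum: "bij_betw enum {..<N} (carrier G)"
  using someI_ex[OF ex_bij_betw_nat_finite[OF finite_carrier]]
  by (simp add: enum_def atLeast0LessThan)

lemma enum_carrier: "i < N \<Longrightarrow> enum i \<in> carrier G"
  using bij_enum by (auto simp: bij_betw_def)

lemma idx_less: "a \<in> carrier G \<Longrightarrow> idx a < N"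
  using bij_enum by (metis bij_betw_def idx_def inv_into_into lessThan_iff)

lemma enum_idx: "a \<in> carrier G \<Longrightarrow> enum (idx a) = a"
  using bij_enum by (auto simp: idx_def bij_betw_def intro!: f_inv_into_f)

lemma idx_enum: "i < N \<Longrightarrow> idx (enum i) = i"
  using bij_enum by (auto simp: idx_def bij_betw_def intro!: inv_into_f_f)

lemma regular_carrier [simp]: "regular a \<in> carrier_mat N N"
  by (simp add: regular_def)

lemma regular_mult_vec:
  assumes a: "a \<in> carrier G" and b: "b \<in> carrier G" and y: "y \<in> carrier_vec N"
  shows "(regular a *\<^sub>v y) $ idx (a \<otimes> b) = C a b * y $ idx b"
proof -
  have "(regular a *\<^sub>v y) $ idx (a \<otimes> b) = (\<Sum>j<N. regular a $$ (idx (a \<otimes> b), j) * y $ j)"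
    using a b y by (intro index_mult_mat_vec_sum[OF regular_carrier]) (simp_all add: idx_less)
  also have "\<dots> = (\<Sum>j<N. if j = idx b then C a b * y $ idx b else 0)"
  proof (intro sum.cong refl)
    fix j assume "j \<in> {..<N}"
    then have j: "j < N" by simp
    have "a \<otimes> enum j = a \<otimes> b \<longleftrightarrow> j = idx b"
      using a b j enum_carrier[OF j] enum_idx[OF b] idx_enum[OF j] by auto
    then show "regular a $$ (idx (a \<otimes> b), j) * y $ j = (if j = idx b then C a b * y $ idx b else 0)"
      using a b j by (simp add: regular_def idx_less enum_idx)
  qed
  also have "\<dots> = C a b * y $ idx b" using b by (simp add: idx_less)
  finally show ?thesis .
qed

text \<open>Every index has the form \<open>idx (a \<otimes> b)\<close>, since translation by a
  permutes G. In this form \<open>regular_mult_vec\<close> gives the coordinates of an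
  image.\<close>

lemma vec_eq_translateI:
  assumes x: "x \<in> carrier_vec N" and y: "y \<in> carrier_vec N" and a: "a \<in> carrier G"
    and eq: "\<And>b. b \<in> carrier G \<Longrightarrow> x $ idx (a \<otimes> b) = y $ idx (a \<otimes> b)"
  shows "x = y"
proof (rule eq_vecI)
  fix i assume "i < dim_vec y"
  then have i: "i < N" using y by simp
  have "a \<otimes> (inv a \<otimes> enum i) = enum i"
    using a enum_carrier[OF i] by (simp add: m_assoc[symmetric])
  then have "idx (a \<otimes> (inv a \<otimes> enum i)) = i" using idx_enum[OF i] by simp
  then show "x $ i = y $ i" using eq[of "inv a \<otimes> enum i"] a enum_carrier[OF i] by simp
qed (use x y in simp)

text \<open>On coordinates at abc the product law is literally the cocycle identity, and the law at
  the identity is C(e, b) = 1.\<close>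

lemma proj_rep_regular: "proj_rep N regular"
  unfolding proj_rep_def
proof (intro conjI ballI)
  fix a b assume a: "a \<in> carrier G" and b: "b \<in> carrier G"
  show "regular a * regular b = C a b \<cdot>\<^sub>m regular (a \<otimes> b)"
  proof (rule mat_eq_on_vecI[of _ N N])
    fix y :: "complex vec" assume y: "y \<in> carrier_vec N"
    note v = mult_mat_vec_carrier[OF regular_carrier]
    have "regular a *\<^sub>v (regular b *\<^sub>v y) = C a b \<cdot>\<^sub>v (regular (a \<otimes> b) *\<^sub>v y)"
    proof (rule vec_eq_translateI[of _ _ "a \<otimes> b"])
      fix c assume c: "c \<in> carrier G"
      have "(regular a *\<^sub>v (regular b *\<^sub>v y)) $ idx (a \<otimes> b \<otimes> c) = C a (b \<otimes> c) * (C b c * y $ idx c)"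
        using a b c y v[OF y] by (simp add: m_assoc regular_mult_vec del: index_mult_mat_vec)
      also have "\<dots> = C b c * C a (b \<otimes> c) * y $ idx c" by (simp only: mult_ac)
      also have "\<dots> = C a b * (C (a \<otimes> b) c * y $ idx c)"
        by (simp only: cocycle[OF a b c, symmetric] mult.assoc)
      also have "\<dots> = (C a b \<cdot>\<^sub>v (regular (a \<otimes> b) *\<^sub>v y)) $ idx (a \<otimes> b \<otimes> c)"
        using a b c y idx_less[of "a \<otimes> b \<otimes> c"] regular_mult_vec[of "a \<otimes> b" c y]
          carrier_matD(1)[OF regular_carrier, of "a \<otimes> b"]
        by (simp del: index_mult_mat_vec)
      finally show "(regular a *\<^sub>v (regular b *\<^sub>v y)) $ idx (a \<otimes> b \<otimes> c)
          = (C a b \<cdot>\<^sub>v (regular (a \<otimes> b) *\<^sub>v y)) $ idx (a \<otimes> b \<otimes> c)" .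
    qed (use a b y v in simp_all)
    then show "regular a * regular b *\<^sub>v y = C a b \<cdot>\<^sub>m regular (a \<otimes> b) *\<^sub>v y"
      using y by (simp add: assoc_mult_mat_vec[of _ N N _ N] smult_mat_mult_vec[of _ N N])
  qed (simp_all add: mult_carrier_mat[of _ N N])
next
  show "regular \<one> = 1\<^sub>m N"
  proof (rule mat_eq_on_vecI[of _ N N])
    fix y :: "complex vec" assume y: "y \<in> carrier_vec N"
    have "regular \<one> *\<^sub>v y = y"
    proof (rule vec_eq_translateI[of _ _ \<one>])
      show "regular \<one> *\<^sub>v y \<in> carrier_vec N" by (rule mult_mat_vec_carrier[OF regular_carrier y])
      fix b assume b: "b \<in> carrier G"
      then show "(regular \<one> *\<^sub>v y) $ idx (\<one> \<otimes> b) = y $ idx (\<one> \<otimes> b)"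
        using regular_mult_vec[OF one_closed b y] by (simp add: C_one_left del: index_mult_mat_vec)
    qed (use y in simp_all)
    then show "regular \<one> *\<^sub>v y = 1\<^sub>m N *\<^sub>v y" using y by simp
  qed simp_all
qed simp

text \<open>The unit vector stands for 1 = v_e in W, so this is f times 1 equals f. It rests on C(a,
  e) = 1.\<close>

lemma regular_eval_unit:
  "rep_eval N regular f *\<^sub>v unit_vec N (idx \<one>) = vec N (\<lambda>i. f (enum i))"
proof (rule eq_vecI)
  fix i assume "i < dim_vec (vec N (\<lambda>i. f (enum i)))"
  then have i: "i < N" by simp
  have "(rep_eval N regular f *\<^sub>v unit_vec N (idx \<one>)) $ i = rep_eval N regular f $$ (i, idx \<one>)"
    using i idx_less[OF one_closed] carrier_matD[OF rep_eval_carrier, of N regular f] by simp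
  also have "\<dots> = (\<Sum>a\<in>carrier G. f a * regular a $$ (i, idx \<one>))"
    using i by (intro rep_eval_index proj_rep_regular) (simp_all add: idx_less)
  also have "\<dots> = (\<Sum>a\<in>carrier G. if a = enum i then f a else 0)"
    using i by (intro sum.cong) (auto simp: regular_def idx_less enum_idx C_one_right enum_carrier)
  also have "\<dots> = f (enum i)" using finite_carrier enum_carrier[OF i] by simp
  finally show "(rep_eval N regular f *\<^sub>v unit_vec N (idx \<one>)) $ i = vec N (\<lambda>i. f (enum i)) $ i"
    using i by simp
qed (simp add: carrier_matD[OF rep_eval_carrier])

text \<open>The translation of a by b trades the twist C(b, a) for the product \<pi>(b) \<pi>(a). It
  follows that kernels of evaluations are left ideals.\<close>

lemma rep_eval_regular_mult:
  assumes \<pi>: "proj_rep n \<pi>" and b: "b \<in> carrier G" and y: "y \<in> carrier_vec N"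
  shows "rep_eval n \<pi> (\<lambda>a. (regular b *\<^sub>v y) $ idx a) = \<pi> b * rep_eval n \<pi> (\<lambda>a. y $ idx a)"
proof -
  have "rep_eval n \<pi> (\<lambda>a. (regular b *\<^sub>v y) $ idx a)
      = mat_sum n n (\<lambda>a. (regular b *\<^sub>v y) $ idx (b \<otimes> a) \<cdot>\<^sub>m \<pi> (b \<otimes> a)) (carrier G)"
    unfolding rep_eval_def by (rule mat_sum_reindex[OF bij_betw_left_translation[OF b]])
  also have "\<dots> = mat_sum n n (\<lambda>a. y $ idx a \<cdot>\<^sub>m (\<pi> b * \<pi> a)) (carrier G)"
    using b y by (intro mat_sum_cong)
      (simp add: regular_mult_vec proj_rep_mult[OF \<pi>] smult_smult_mat mult.commute del: index_mult_mat_vec)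
  also have "\<dots> = \<pi> b * rep_eval n \<pi> (\<lambda>a. y $ idx a)"
    by (rule mult_rep_eval_left[OF \<pi> proj_rep_carrier[OF \<pi> b], symmetric])
  finally show ?thesis .
qed

text \<open>If the common kernel \<open>K\<close> of the family were nonzero, it would contain a minimal left ideal,
  the column space of \<open>B\<close>, whose representation is isomorphic to a member of the family, so that
  \<open>K\<close> kills \<open>B\<close>. The average \<open>P\<close> of the projection \<open>B * D\<close> commutes with left multiplications, so
  \<open>P y = P (y 1) = y (P 1) = 0\<close> for \<open>y\<close> in the column space, although \<open>P\<close> acts on it as the scalar \<open>N\<close>.\<close>

lemma rep_eval_family_inj:
  assumes fam: "\<And>i. i < m \<Longrightarrow> irred (n i) (\<pi> i)"
    and complete: "\<And>k \<sigma>. irred k \<sigma> \<Longrightarrow> \<exists>i<m. proj_rep_isomorphic k \<sigma> (n i) (\<pi> i)"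
    and zero: "\<And>i. i < m \<Longrightarrow> rep_eval (n i) (\<pi> i) f = 0\<^sub>m (n i) (n i)"
    and a: "a \<in> carrier G"
  shows "f a = 0"
proof (rule ccontr)
  assume fa: "f a \<noteq> 0"
  have rep: "proj_rep (n i) (\<pi> i)" if "i < m" for i using fam[OF that] by (simp add: irred_def)
  note L = proj_rep_regular
  \<comment> \<open>The common kernel, as coefficient vectors rather than functions, so that it is a
    subspace on which \<open>regular\<close> acts.\<close>
  define K where "K = {y \<in> carrier_vec N. \<forall>i<m. rep_eval (n i) (\<pi> i) (\<lambda>a. y $ idx a) = 0\<^sub>m (n i) (n i)}"
  have Kc: "y \<in> carrier_vec N" if "y \<in> K" for y using that by (simp add: K_def)
  have K_subspace: "subspace complex_field K (module_vec TYPE(complex) N)"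
    unfolding subspace_module_vec_iff
  proof (intro conjI ballI allI)
    show "K \<subseteq> carrier_vec N" using Kc by blast
    have "rep_eval (n i) (\<pi> i) (\<lambda>a. 0\<^sub>v N $ idx a) = 0\<^sub>m (n i) (n i)" if "i < m" for i
      by (rule eq_matI) (simp_all add: rep_eval_index[OF rep[OF that]] idx_less
        carrier_matD[OF rep_eval_carrier])
    then show "0\<^sub>v N \<in> K" by (simp add: K_def)
    fix x assume x: "x \<in> K"
    {
      fix y assume y: "y \<in> K"
      have "rep_eval (n i) (\<pi> i) (\<lambda>a. (x + y) $ idx a) = 0\<^sub>m (n i) (n i)" if "i < m" for i
      proof -
        have "rep_eval (n i) (\<pi> i) (\<lambda>a. (x + y) $ idx a)
            = rep_eval (n i) (\<pi> i) (\<lambda>a. x $ idx a + y $ idx a)"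
          using Kc[OF y] by (intro rep_eval_cong) (simp add: idx_less)
        then show ?thesis using x y that by (simp add: rep_eval_add[OF rep[OF that]] K_def)
      qed
      then show "x + y \<in> K" using Kc[OF x] Kc[OF y] by (simp add: K_def)
    }
    fix c
    have "rep_eval (n i) (\<pi> i) (\<lambda>a. (c \<cdot>\<^sub>v x) $ idx a) = 0\<^sub>m (n i) (n i)" if "i < m" for i
    proof -
      have "rep_eval (n i) (\<pi> i) (\<lambda>a. (c \<cdot>\<^sub>v x) $ idx a)
          = rep_eval (n i) (\<pi> i) (\<lambda>a. c * x $ idx a)"
        using Kc[OF x] by (intro rep_eval_cong) (simp add: idx_less)
      then show ?thesis using x that by (simp add: rep_eval_smult[OF rep[OF that]] K_def)
    qed
    then show "c \<cdot>\<^sub>v x \<in> K" using Kc[OF x] by (simp add: K_def)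
  qed
  have K_inv: "regular b *\<^sub>v y \<in> K" if b: "b \<in> carrier G" and y: "y \<in> K" for b y
  proof -
    have "rep_eval (n i) (\<pi> i) (\<lambda>a. (regular b *\<^sub>v y) $ idx a) = 0\<^sub>m (n i) (n i)" if "i < m" for i
      unfolding rep_eval_regular_mult[OF rep[OF that] b Kc[OF y]]
      using y that proj_rep_carrier[OF rep[OF that] b] by (simp add: K_def)
    then show ?thesis
      using mult_mat_vec_carrier[OF regular_carrier Kc[OF y]] by (simp add: K_def)
  qed
  have K_nonzero: "K \<noteq> {0\<^sub>v N}"
  proof -
    define x where "x = vec N (\<lambda>i. f (enum i))"
    have x: "x $ idx b = f b" if "b \<in> carrier G" for b
      using that by (simp add: x_def idx_less enum_idx)
    have "rep_eval (n i) (\<pi> i) (\<lambda>b. x $ idx b) = 0\<^sub>m (n i) (n i)" if "i < m" for i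
      using zero[OF that] rep_eval_cong[of "\<lambda>b. x $ idx b" f] x by simp
    then have "x \<in> K" by (simp add: K_def x_def)
    moreover have "x \<noteq> 0\<^sub>v N" using x[OF a] fa idx_less[OF a] by auto
    ultimately show ?thesis by auto
  qed
  obtain B k D where B: "B \<in> carrier_mat N k" and D: "D \<in> carrier_mat k N"
    and DB: "D * B = 1\<^sub>m k" and BK: "\<And>x. x \<in> carrier_vec k \<Longrightarrow> B *\<^sub>v x \<in> K"
    and inv_B: "\<And>a. a \<in> carrier G \<Longrightarrow> B * (D * (regular a * B)) = regular a * B"
    and irr: "irred k (\<lambda>a. D * (regular a * B))"
    by (rule exists_irred_subrep[OF L K_subspace K_inv K_nonzero]) blast+
  let ?\<rho> = "\<lambda>a. D * (regular a * B)"
  have rep\<rho>: "proj_rep k ?\<rho>" and k: "0 < k" using irr by (auto simp: irred_def)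
  obtain i where i: "i < m" and iso: "proj_rep_isomorphic k ?\<rho> (n i) (\<pi> i)"
    using complete[OF irr] by blast
  \<comment> \<open>The first column of \<open>B\<close> serves as a nonzero element of the ideal;
    \<open>D\<close> maps it to a unit vector, which contradicts y = 0 at the end.\<close>
  define y where "y = B *\<^sub>v unit_vec k 0"
  have y: "y \<in> K" unfolding y_def by (rule BK) simp
  have yc: "y \<in> carrier_vec N" using Kc[OF y] .
  have Dy: "D *\<^sub>v y = unit_vec k 0"
    unfolding y_def using assoc_mult_mat_vec[OF D B, of "unit_vec k 0"] DB by simp
  define g where "g = (\<lambda>a. y $ idx a)"
  \<comment> \<open>\<open>E\<close> is left multiplication by the algebra element with coordinates
    \<open>y\<close>.\<close>
  define E where "E = rep_eval N regular g"
  have Ec: "E \<in> carrier_mat N N" by (simp add: E_def)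
  note [simp] = carrier_matD[OF B] carrier_matD[OF D] carrier_matD[OF Ec]
    regular_carrier[THEN carrier_matD(1)] regular_carrier[THEN carrier_matD(2)]
  have "rep_eval k ?\<rho> g = 0\<^sub>m k k"
    by (rule rep_eval_isomorphic_zero[OF rep\<rho> rep[OF i] iso])
      (use y i in \<open>simp add: K_def g_def\<close>)
  \<comment> \<open>On the ideal \<open>E\<close> acts through the irreducible representation, which
    kills \<open>y\<close> because \<open>y\<close> lies in \<open>K\<close>. So \<open>y\<close>
    annihilates the whole ideal from the left.\<close>
  moreover have "E * B = B * rep_eval k ?\<rho> g"
    unfolding E_def mult_rep_eval_right[OF L B] mult_rep_eval_left[OF rep\<rho> B]
    by (intro mat_sum_cong) (simp add: inv_B)
  ultimately have EB: "E * B = 0\<^sub>m N k" using B by simp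
  define P where "P = avg N regular N regular (B * D)"
  have BD: "B * D \<in> carrier_mat N N" using B D by simp
  have Pint: "intertwiner N regular N regular P"
    unfolding P_def by (rule avg_intertwiner[OF L L BD])
  have Pc: "P \<in> carrier_mat N N" using Pint by (simp add: intertwiner_def)
  have invc: "rep_inv regular a \<in> carrier_mat N N" if "a \<in> carrier G" for a
    using rep_inv_carrier[OF L that] .
  note [simp] = invc[THEN carrier_matD(1)] invc[THEN carrier_matD(2)]
  have PB: "P * B = of_nat N \<cdot>\<^sub>m B"
  proof -
    \<comment> \<open>The inverse action keeps the columns of \<open>B\<close> in the ideal, where
      \<open>B * D\<close> is the identity; so each conjugated projection fixes
      \<open>B\<close>.\<close>
    have summand: "regular a * (B * D) * rep_inv regular a * B = B" if a: "a \<in> carrier G" for a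
    proof -
      have "B * (D * (rep_inv regular a * B)) = rep_inv regular a * B"
        unfolding rep_inv_def using a by (simp add: mat_dim_simps inv_B)
      then have "regular a * (B * D) * rep_inv regular a * B = regular a * (rep_inv regular a * B)"
        using a by (simp add: mat_dim_simps)
      also have "\<dots> = regular a * rep_inv regular a * B" using a by (simp add: mat_dim_simps)
      finally show ?thesis using B by (simp add: rep_inv_right[OF L a])
    qed
    have "P * B = mat_sum N k (\<lambda>a. regular a * (B * D) * rep_inv regular a * B) (carrier G)"
      unfolding P_def avg_def using B BD invc
      by (intro mult_mat_sum_right) (auto intro!: mult_carrier_mat[of _ N N])
    also have "\<dots> = mat_sum N k (\<lambda>a. B) (carrier G)"
      by (intro mat_sum_cong summand)
    also have "\<dots> = of_nat N \<cdot>\<^sub>m B"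
      by (rule eq_matI) (simp_all add: mat_sum_index carrier_matD[OF mat_sum_carrier])
    finally show ?thesis .
  qed
  have EP: "E * P = 0\<^sub>m N N"
  proof -
    \<comment> \<open>Each conjugated projection has its image in the ideal, because
      \<open>regular a * B\<close> has its columns there, and \<open>E\<close> vanishes on the
      ideal.\<close>
    have summand: "E * (regular a * (B * D) * rep_inv regular a) = 0\<^sub>m N N" if a: "a \<in> carrier G" for a
    proof -
      have "E * (regular a * (B * D) * rep_inv regular a)
          = E * (regular a * B) * (D * rep_inv regular a)"
        using a by (simp add: mat_dim_simps)
      also have "\<dots> = E * (B * (D * (regular a * B))) * (D * rep_inv regular a)"
        by (simp only: inv_B[OF a])
      also have "\<dots> = E * B * (D * (regular a * B) * (D * rep_inv regular a))"
        using a by (simp add: mat_dim_simps)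
      also have "\<dots> = 0\<^sub>m N k * (D * (regular a * B) * (D * rep_inv regular a))"
        by (simp only: EB)
      also have "\<dots> = 0\<^sub>m N N"
        using a by (intro left_mult_zero_mat[of _ k N] carrier_matI) simp_all
      finally show ?thesis .
    qed
    have "E * P = mat_sum N N (\<lambda>a. E * (regular a * (B * D) * rep_inv regular a)) (carrier G)"
      unfolding P_def avg_def using Ec BD invc
      by (intro mult_mat_sum_left) (auto intro!: mult_carrier_mat[of _ N N])
    also have "\<dots> = mat_sum N N (\<lambda>a. 0\<^sub>m N N) (carrier G)"
      by (intro mat_sum_cong summand)
    also have "\<dots> = 0\<^sub>m N N"
      by (rule eq_matI) (simp_all add: mat_sum_index carrier_matD[OF mat_sum_carrier])
    finally show ?thesis .
  qed
  have "y = E *\<^sub>v unit_vec N (idx \<one>)"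
    unfolding E_def regular_eval_unit using yc by (intro eq_vecI) (simp_all add: g_def idx_enum)
  then have "P *\<^sub>v y = P * E *\<^sub>v unit_vec N (idx \<one>)"
    using assoc_mult_mat_vec[OF Pc Ec] by simp
  also have "P * E = 0\<^sub>m N N"
    using intertwiner_rep_eval[OF L L Pint, of g] EP by (simp add: E_def)
  also have "0\<^sub>m N N *\<^sub>v unit_vec N (idx \<one>) = (0\<^sub>v N :: complex vec)"
    by (auto intro!: eq_vecI)
  finally have "P *\<^sub>v y = 0\<^sub>v N" .
  moreover have "P *\<^sub>v y = of_nat N \<cdot>\<^sub>v y"
    unfolding y_def using assoc_mult_mat_vec[OF Pc B, of "unit_vec k 0"] PB
      smult_mat_mult_vec[OF B, of "unit_vec k 0"] by simp
  ultimately have Ny: "of_nat N \<cdot>\<^sub>v y = 0\<^sub>v N" by simp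
  have "y = 0\<^sub>v N"
  proof (rule eq_vecI)
    fix j assume "j < dim_vec (0\<^sub>v N :: complex vec)"
    then have j: "j < N" by simp
    have "(of_nat N \<cdot>\<^sub>v y) $ j = 0" using Ny j by simp
    then show "y $ j = 0\<^sub>v N $ j" using j yc by simp
  qed (use yc in simp)
  moreover have "D *\<^sub>v 0\<^sub>v N = 0\<^sub>v k"
    by (rule eq_vecI) (simp_all add: scalar_prod_def)
  ultimately have "unit_vec k 0 $ 0 = (0\<^sub>v k :: complex vec) $ 0"
    using Dy by simp
  then show False using k by simp
qed

subsection \<open>Complete families of irreducible representations\<close>

text \<open>The inverse of \<open>T\<close> on vectors is linear and hence a matrix. Symmetry is
  called for when a family is extended, as its members must be non-isomorphic in both
  orders.\<close>

lemma proj_rep_isomorphic_sym: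
  assumes \<pi>: "proj_rep n \<pi>" and \<sigma>: "proj_rep p \<sigma>" and iso: "proj_rep_isomorphic n \<pi> p \<sigma>"
  shows "proj_rep_isomorphic p \<sigma> n \<pi>"
proof -
  from iso obtain T where T: "intertwiner n \<pi> p \<sigma> T"
    and bij: "bij_betw (\<lambda>x. T *\<^sub>v x) (carrier_vec n) (carrier_vec p)"
    by (auto simp: proj_rep_isomorphic_def)
  have Tc: "T \<in> carrier_mat p n" using T by (simp add: intertwiner_def)
  define S where "S = inv_into (carrier_vec n) (\<lambda>x. T *\<^sub>v x)"
  have Sc: "S y \<in> carrier_vec n" if "y \<in> carrier_vec p" for y
    using bij that unfolding S_def bij_betw_def by (metis inv_into_into)
  have TS: "T *\<^sub>v S y = y" if "y \<in> carrier_vec p" for y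
    using bij_betw_inv_into_right[OF bij that] by (simp add: S_def)
  have ST: "S (T *\<^sub>v x) = x" if "x \<in> carrier_vec n" for x
    using bij_betw_inv_into_left[OF bij that] by (simp add: S_def)
  have S_eqI: "S y = x" if "x \<in> carrier_vec n" "T *\<^sub>v x = y" for x y using ST that by blast
  obtain M where M: "M \<in> carrier_mat n p" and SM: "\<And>y. y \<in> carrier_vec p \<Longrightarrow> S y = M *\<^sub>v y"
  proof (rule linear_on_vec_eq_mat[of p S n])
    show "S y \<in> carrier_vec n" if "y \<in> carrier_vec p" for y by (rule Sc[OF that])
    show "S (x + y) = S x + S y" if "x \<in> carrier_vec p" "y \<in> carrier_vec p" for x y
      using that Sc TS by (intro S_eqI) (simp_all add: mult_add_distrib_mat_vec[OF Tc])
    show "S (c \<cdot>\<^sub>v x) = c \<cdot>\<^sub>v S x" if "x \<in> carrier_vec p" for c x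
      using that Sc TS by (intro S_eqI) (simp_all add: mult_mat_vec[OF Tc])
  qed blast
  have "M * \<sigma> a = \<pi> a * M" if a: "a \<in> carrier G" for a
  proof (rule mat_eq_on_vecI[of _ n p])
    note \<pi>c = proj_rep_carrier[OF \<pi> a] and \<sigma>c = proj_rep_carrier[OF \<sigma> a]
    show "M * \<sigma> a \<in> carrier_mat n p" "\<pi> a * M \<in> carrier_mat n p" using M \<pi>c \<sigma>c by auto
    fix y :: "complex vec" assume y: "y \<in> carrier_vec p"
    have "T *\<^sub>v (\<pi> a *\<^sub>v S y) = T * \<pi> a *\<^sub>v S y"
      using assoc_mult_mat_vec[OF Tc \<pi>c Sc[OF y]] by simp
    also have "\<dots> = \<sigma> a * T *\<^sub>v S y" using T a by (simp add: intertwiner_def)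
    also have "\<dots> = \<sigma> a *\<^sub>v y" using assoc_mult_mat_vec[OF \<sigma>c Tc Sc[OF y]] TS[OF y] by simp
    finally have "S (\<sigma> a *\<^sub>v y) = \<pi> a *\<^sub>v S y"
      using mult_mat_vec_carrier[OF \<pi>c Sc[OF y]] by (intro S_eqI)
    then show "M * \<sigma> a *\<^sub>v y = \<pi> a * M *\<^sub>v y"
      using SM[OF y] SM[OF mult_mat_vec_carrier[OF \<sigma>c y]] assoc_mult_mat_vec[OF M \<sigma>c y]
        assoc_mult_mat_vec[OF \<pi>c M y] by simp
  qed
  moreover have "bij_betw (\<lambda>y. M *\<^sub>v y) (carrier_vec p) (carrier_vec n)"
    using bij_betw_inv_into[OF bij] SM bij_betw_cong[of "carrier_vec p" S "\<lambda>y. M *\<^sub>v y" "carrier_vec n"]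
    unfolding S_def by simp
  ultimately show ?thesis using M by (auto simp: proj_rep_isomorphic_def intertwiner_def)
qed

definition irred_family :: "nat \<Rightarrow> (nat \<Rightarrow> nat) \<Rightarrow> (nat \<Rightarrow> 'g \<Rightarrow> complex mat) \<Rightarrow> bool" where
  "irred_family m n \<pi> \<longleftrightarrow> (\<forall>i<m. irred (n i) (\<pi> i)) \<and>
    (\<forall>i<m. \<forall>j<m. i \<noteq> j \<longrightarrow> \<not> proj_rep_isomorphic (n i) (\<pi> i) (n j) (\<pi> j))"

text \<open>The Fourier inversion formula: a sum of n_i / |G| times the trace of \<pi>_i(a)^-1 M_i,
  with the trace written out in entries.\<close>

definition fourier_inv ::
  "nat \<Rightarrow> (nat \<Rightarrow> nat) \<Rightarrow> (nat \<Rightarrow> 'g \<Rightarrow> complex mat) \<Rightarrow> (nat \<Rightarrow> complex mat) \<Rightarrow> 'g \<Rightarrow> complex" where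
  "fourier_inv m n \<pi> M a = (\<Sum>i<m. of_nat (n i) / of_nat N *
    (\<Sum>k<n i. \<Sum>l<n i. rep_inv (\<pi> i) a $$ (k, l) * M i $$ (l, k)))"

lemma card_carrier_pos: "0 < N"
  using finite_carrier one_closed by (auto simp: card_gt_0_iff)

lemma rep_eval_fourier_inv:
  assumes fam: "irred_family m n \<pi>" and j: "j < m" and M: "M j \<in> carrier_mat (n j) (n j)"
  shows "rep_eval (n j) (\<pi> j) (fourier_inv m n \<pi> M) = M j"
proof (rule eq_matI)
  fix r q assume "r < dim_row (M j)" "q < dim_col (M j)"
  then have r: "r < n j" and q: "q < n j" using M by auto
  have irr: "irred (n i) (\<pi> i)" if "i < m" for i using fam that by (simp add: irred_family_def)
  have rep: "proj_rep (n j) (\<pi> j)" and nj: "0 < n j" using irr[OF j] by (auto simp: irred_def)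
  let ?S = "\<lambda>i k l. \<Sum>a\<in>carrier G. \<pi> j a $$ (r, q) * rep_inv (\<pi> i) a $$ (k, l)"
  have "rep_eval (n j) (\<pi> j) (fourier_inv m n \<pi> M) $$ (r, q)
      = (\<Sum>a\<in>carrier G. fourier_inv m n \<pi> M a * \<pi> j a $$ (r, q))"
    using rep r q by (rule rep_eval_index)
  also have "\<dots> = (\<Sum>a\<in>carrier G. \<Sum>i<m. \<Sum>k<n i. \<Sum>l<n i.
      of_nat (n i) / of_nat N * M i $$ (l, k) * (\<pi> j a $$ (r, q) * rep_inv (\<pi> i) a $$ (k, l)))"
    unfolding fourier_inv_def sum_distrib_left sum_distrib_right
    by (intro sum.cong refl) (simp only: mult_ac)
  \<comment> \<open>Moving the sum over G to the inside exposes the orthogonality sums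
    \<open>?S\<close>. The terms with i \<noteq> j vanish, and for i = j only k = q, l = r is left,
    with |G| / n_j cancelling the weight.\<close>
  also have "\<dots> = (\<Sum>i<m. \<Sum>k<n i. \<Sum>l<n i. of_nat (n i) / of_nat N * M i $$ (l, k) * ?S i k l)"
    unfolding sum_distrib_left
    by (subst sum.swap, rule sum.cong[OF refl], subst sum.swap, rule sum.cong[OF refl], rule sum.swap)
  also have "\<dots> = (\<Sum>i<m. if i = j then \<Sum>k<n j. \<Sum>l<n j.
      of_nat (n j) / of_nat N * M j $$ (l, k) * ?S j k l else 0)"
  proof (intro sum.cong refl)
    fix i assume "i \<in> {..<m}"
    then have i: "i < m" by simp
    show "(\<Sum>k<n i. \<Sum>l<n i. of_nat (n i) / of_nat N * M i $$ (l, k) * ?S i k l)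
      = (if i = j then \<Sum>k<n j. \<Sum>l<n j. of_nat (n j) / of_nat N * M j $$ (l, k) * ?S j k l else 0)"
    proof (cases "i = j")
      case False
      have "?S i k l = 0" if "k < n i" "l < n i" for k l
        using orthogonality_distinct[OF irr[OF i] irr[OF j] _ r q that] fam i j False
        by (simp add: irred_family_def)
      then show ?thesis using False by simp
    qed simp
  qed
  also have "\<dots> = (\<Sum>k<n j. \<Sum>l<n j. of_nat (n j) / of_nat N * M j $$ (l, k) * ?S j k l)"
    using j by simp
  also have "\<dots> = (\<Sum>k<n j. \<Sum>l<n j. if k = q then if l = r then M j $$ (r, q) else 0 else 0)"
    using nj card_carrier_pos
    by (intro sum.cong refl) (auto simp: orthogonality_same[OF irr[OF j] r q])
  also have "\<dots> = (\<Sum>k<n j. if k = q then M j $$ (r, q) else 0)"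
    using r by (intro sum.cong refl) simp
  also have "\<dots> = M j $$ (r, q)" using q by simp
  finally show "rep_eval (n j) (\<pi> j) (fourier_inv m n \<pi> M) $$ (r, q) = M j $$ (r, q)" .
qed (use M in \<open>auto simp: carrier_matD[OF rep_eval_carrier]\<close>)

text \<open>Column j of \<open>B\<close> is a function on G evaluating to the identity in member j
  and to zero in the others; row i of \<open>D\<close> reads off entry (0, 0) of the evaluation in
  member i, which exists as sizes are positive. So \<open>D\<close> is a left inverse of
  \<open>B\<close>.\<close>

lemma irred_family_card_le:
  assumes fam: "irred_family m n \<pi>"
  shows "m \<le> N"
proof (rule left_inverse_dim_le)
  define M where "M j i = (if i = j then 1\<^sub>m (n i) else 0\<^sub>m (n i) (n i) :: complex mat)" for i j
  define B where "B = mat N m (\<lambda>(x, j). fourier_inv m n \<pi> (M j) (enum x))"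
  define D where "D = mat m N (\<lambda>(i, x). \<pi> i (enum x) $$ (0, 0))"
  show B: "B \<in> carrier_mat N m" and D: "D \<in> carrier_mat m N" by (auto simp: B_def D_def)
  show "D * B = 1\<^sub>m m"
  proof (rule eq_matI)
    fix i j assume "i < dim_row (1\<^sub>m m :: complex mat)" "j < dim_col (1\<^sub>m m :: complex mat)"
    then have i: "i < m" and j: "j < m" by auto
    have rep: "proj_rep (n i) (\<pi> i)" and ni: "0 < n i"
      using fam i by (auto simp: irred_family_def irred_def)
    have "(D * B) $$ (i, j) = (\<Sum>x<N. D $$ (i, x) * B $$ (x, j))"
      using D B i j by (rule index_mult_mat_sum)
    also have "\<dots> = (\<Sum>x<N. fourier_inv m n \<pi> (M j) (enum x) * \<pi> i (enum x) $$ (0, 0))"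
      using i j by (intro sum.cong refl) (simp add: B_def D_def)
    also have "\<dots> = (\<Sum>a\<in>carrier G. fourier_inv m n \<pi> (M j) a * \<pi> i a $$ (0, 0))"
      by (rule sum.reindex_bij_betw[OF bij_enum])
    also have "\<dots> = rep_eval (n i) (\<pi> i) (fourier_inv m n \<pi> (M j)) $$ (0, 0)"
      using rep ni by (simp add: rep_eval_index)
    also have "\<dots> = M j i $$ (0, 0)"
      by (subst rep_eval_fourier_inv[OF fam i]) (simp_all add: M_def)
    finally show "(D * B) $$ (i, j) = 1\<^sub>m m $$ (i, j)" using i j ni by (cases "i = j") (simp_all add: M_def)
  qed (use B D in auto)
qed

text \<open>As the length of a family is bounded, a longest one exists; an irreducible missing from
  it could be appended.\<close>

lemma exists_complete_irred_family:
  obtains m n \<pi> where "irred_family m n \<pi>"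
    "\<And>k \<sigma>. irred k \<sigma> \<Longrightarrow> \<exists>i<m. proj_rep_isomorphic k \<sigma> (n i) (\<pi> i)"
proof -
  define Q where "Q m \<longleftrightarrow> (\<exists>n \<pi>. irred_family m n \<pi>)" for m
  have "Q 0" by (simp add: Q_def irred_family_def)
  moreover have "m \<le> N" if "Q m" for m using that irred_family_card_le by (auto simp: Q_def)
  ultimately obtain m where m: "Q m" and max: "\<And>l. Q l \<Longrightarrow> l \<le> m"
    using ex_has_greatest_nat[of Q 0 "\<lambda>x. x" "Suc N"] by (metis le_imp_less_Suc)
  from m obtain n \<pi> where fam: "irred_family m n \<pi>" by (auto simp: Q_def)
  have "\<exists>i<m. proj_rep_isomorphic k \<sigma> (n i) (\<pi> i)" if \<sigma>: "irred k \<sigma>" for k \<sigma>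
  proof (rule ccontr)
    assume not: "\<not> ?thesis"
    then have not': "\<not> proj_rep_isomorphic (n i) (\<pi> i) k \<sigma>" if "i < m" for i
      using that fam \<sigma> proj_rep_isomorphic_sym[of "n i" "\<pi> i" k \<sigma>]
      by (auto simp: irred_family_def irred_def)
    have "irred_family (Suc m) (n(m := k)) (\<pi>(m := \<sigma>))"
      using fam \<sigma> not not' by (auto simp: irred_family_def less_Suc_eq)
    then have "Q (Suc m)" by (auto simp: Q_def)
    then show False using max by fastforce
  qed
  with fam show ?thesis by (rule that)
qed

end

subsection \<open>Coordinates in a graded twisted algebra\<close>

locale twisted_algebra_basis = graded_twisted_algebra G W grade
  for G :: "'g monoid" and W :: "(complex, 'w) module" (structure) and grade :: "'g \<Rightarrow> 'w set" +
  fixes v :: "'g \<Rightarrow> 'w" and C :: "'g \<Rightarrow> 'g \<Rightarrow> complex"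
  assumes finite_G: "finite (carrier G)"
    and associative: "\<lbrakk>x \<in> carrier W; y \<in> carrier W; z \<in> carrier W\<rbrakk>
      \<Longrightarrow> (x \<otimes> y) \<otimes> z = x \<otimes> (y \<otimes> z)"
    and graded_basis: "graded_basis G W grade v"
    and structure_constant: "structure_constant G W v C"
begin

lemma v_grade: "a \<in> carrier G \<Longrightarrow> v a \<in> grade a"
  and v_basis: "basis (v ` carrier G)"
  and v_one: "v \<one>\<^bsub>G\<^esub> = \<one>"
  using graded_basis by (auto simp: graded_basis_def)

lemma v_in [simp]: "a \<in> carrier G \<Longrightarrow> v a \<in> carrier W"
  using v_basis by (auto simp: basis_def)

lemma v_nonzero: "a \<in> carrier G \<Longrightarrow> v a \<noteq> \<zero>"
  using vs_zero_lin_dep[of "v ` carrier G"] v_basis by (metis basis_def imageI)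

lemma smult_in [simp]: "x \<in> carrier W \<Longrightarrow> c \<odot> x \<in> carrier W"
  using smult_closed[of c x] by simp

lemma smult_smult: "x \<in> carrier W \<Longrightarrow> c \<odot> (d \<odot> x) = (c * d) \<odot> x"
  using smult_assoc1[of c d x] by simp

lemma smult_add_scalar: "x \<in> carrier W \<Longrightarrow> (c + d) \<odot> x = c \<odot> x \<oplus> d \<odot> x"
  using smult_l_distr[of c d x] by simp

lemma smult_add_vector: "x \<in> carrier W \<Longrightarrow> y \<in> carrier W \<Longrightarrow> c \<odot> (x \<oplus> y) = c \<odot> x \<oplus> c \<odot> y"
  using smult_r_distr[of c x y] by simp

lemma smult_zero_scalar: "x \<in> carrier W \<Longrightarrow> 0 \<odot> x = \<zero>"
  using smult_l_null[of x] by simp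

lemma smult_zero_vector: "c \<odot> \<zero> = \<zero>"
  using smult_r_null[of c] by simp

lemma one_smult: "x \<in> carrier W \<Longrightarrow> 1 \<odot> x = x"
  using smult_one[of x] by simp

lemma smult_cancel:
  assumes eq: "c \<odot> x = d \<odot> x" and x: "x \<in> carrier W" "x \<noteq> \<zero>"
  shows "c = d"
proof (rule ccontr)
  assume "c \<noteq> d"
  have "(c - d) \<odot> x \<oplus> d \<odot> x = c \<odot> x"
    using smult_add_scalar[OF x(1), of "c - d" d] by simp
  then have zero: "(c - d) \<odot> x = \<zero>"
    using eq x(1) by simp
  have "x = inverse (c - d) \<odot> ((c - d) \<odot> x)"
    using \<open>c \<noteq> d\<close> x(1) by (simp add: smult_smult one_smult)
  with zero x(2) show False by (simp add: smult_zero_vector)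
qed

lemma v_mult: "a \<in> carrier G \<Longrightarrow> b \<in> carrier G \<Longrightarrow> v a \<otimes> v b = C a b \<odot> v (a \<otimes>\<^bsub>G\<^esub> b)"
  and C_nonzero: "a \<in> carrier G \<Longrightarrow> b \<in> carrier G \<Longrightarrow> C a b \<noteq> 0"
  using structure_constant by (auto simp: structure_constant_def)

lemma C_cocycle:
  assumes a: "a \<in> carrier G" and b: "b \<in> carrier G" and c: "c \<in> carrier G"
  shows "C a b * C (a \<otimes>\<^bsub>G\<^esub> b) c = C b c * C a (b \<otimes>\<^bsub>G\<^esub> c)"
proof (rule smult_cancel)
  have "(v a \<otimes> v b) \<otimes> v c = (C a b * C (a \<otimes>\<^bsub>G\<^esub> b) c) \<odot> v (a \<otimes>\<^bsub>G\<^esub> b \<otimes>\<^bsub>G\<^esub> c)"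
    using a b c by (simp add: v_mult mult_smult_left smult_smult)
  moreover have "v a \<otimes> (v b \<otimes> v c) = (C b c * C a (b \<otimes>\<^bsub>G\<^esub> c)) \<odot> v (a \<otimes>\<^bsub>G\<^esub> b \<otimes>\<^bsub>G\<^esub> c)"
    using a b c by (simp add: v_mult mult_smult_right smult_smult G.m_assoc)
  ultimately show "(C a b * C (a \<otimes>\<^bsub>G\<^esub> b) c) \<odot> v (a \<otimes>\<^bsub>G\<^esub> b \<otimes>\<^bsub>G\<^esub> c)
      = (C b c * C a (b \<otimes>\<^bsub>G\<^esub> c)) \<odot> v (a \<otimes>\<^bsub>G\<^esub> b \<otimes>\<^bsub>G\<^esub> c)"
    using associative[of "v a" "v b" "v c"] a b c by simp
qed (use a b c v_nonzero in simp_all)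

text \<open>Associativity of W supplies the cocycle identity and v_e = 1 the normalization, so the
  matrix theory becomes available for W.\<close>

sublocale tc: twisted_cocycle G C
proof
  show "C \<one>\<^bsub>G\<^esub> a = 1" if a: "a \<in> carrier G" for a
    using v_mult[of "\<one>\<^bsub>G\<^esub>" a] a v_one one_mult_left[of "v a"] v_nonzero
    by (intro smult_cancel[of _ "v a"]) (simp_all add: one_smult)
  show "C a \<one>\<^bsub>G\<^esub> = 1" if a: "a \<in> carrier G" for a
    using v_mult[of a "\<one>\<^bsub>G\<^esub>"] a v_one one_mult_right[of "v a"] v_nonzero
    by (intro smult_cancel[of _ "v a"]) (simp_all add: one_smult)
qed (use finite_G C_nonzero C_cocycle in auto)

text \<open>General index sets \<open>S\<close> permit induction over finite subsets of G; the
  coordinates themselves belong to the full carrier.\<close>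

definition comb_on :: "'g set \<Rightarrow> ('g \<Rightarrow> complex) \<Rightarrow> 'w" where
  "comb_on S f = (\<Oplus>a\<in>S. f a \<odot> v a)"

abbreviation comb :: "('g \<Rightarrow> complex) \<Rightarrow> 'w" where
  "comb \<equiv> comb_on (carrier G)"

lemma comb_on_closed [simp]: "S \<subseteq> carrier G \<Longrightarrow> comb_on S f \<in> carrier W"
  unfolding comb_on_def by (rule M.finsum_closed) auto

lemma comb_on_empty [simp]: "comb_on {} f = \<zero>"
  by (simp add: comb_on_def)

lemma comb_on_insert:
  "\<lbrakk>finite S; a \<notin> S; a \<in> carrier G; S \<subseteq> carrier G\<rbrakk> \<Longrightarrow> comb_on (insert a S) f = f a \<odot> v a \<oplus> comb_on S f"
  unfolding comb_on_def by (rule M.finsum_insert) auto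

lemma comb_on_cong:
  "\<lbrakk>S \<subseteq> carrier G; \<And>a. a \<in> S \<Longrightarrow> f a = g a\<rbrakk> \<Longrightarrow> comb_on S f = comb_on S g"
  unfolding comb_on_def by (rule M.finsum_cong') auto

lemma comb_add: "comb (\<lambda>a. f a + g a) = comb f \<oplus> comb g"
proof -
  have "comb (\<lambda>a. f a + g a) = (\<Oplus>a\<in>carrier G. f a \<odot> v a \<oplus> g a \<odot> v a)"
    unfolding comb_on_def by (rule M.finsum_cong') (auto simp: smult_add_scalar)
  also have "\<dots> = comb f \<oplus> comb g"
    unfolding comb_on_def by (rule M.finsum_addf) auto
  finally show ?thesis .
qed

lemma comb_on_smult:
  assumes "finite S" "S \<subseteq> carrier G"
  shows "comb_on S (\<lambda>a. c * f a) = c \<odot> comb_on S f"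
  using assms by (induction rule: finite_induct)
    (simp_all add: comb_on_insert smult_add_vector smult_smult smult_zero_vector)

lemma comb_single: "a \<in> carrier G \<Longrightarrow> comb (\<lambda>b. if b = a then c else 0) = c \<odot> v a"
proof -
  assume a: "a \<in> carrier G"
  have "comb (\<lambda>b. if b = a then c else 0) = (\<Oplus>b\<in>carrier G. if a = b then c \<odot> v b else \<zero>)"
    unfolding comb_on_def by (rule M.finsum_cong') (auto simp: smult_zero_scalar)
  also have "\<dots> = c \<odot> v a"
    using a finite_G by (intro M.finsum_singleton) auto
  finally show ?thesis .
qed

lemma comb_inj:
  assumes eq: "comb f = comb g" and a: "a \<in> carrier G"
  shows "f a = g a"
proof -
  define F where "F f = (\<lambda>a\<in>carrier G. f a \<odot> v a)" for f
  define P where "P f' \<longleftrightarrow> f' \<in> (\<Pi>\<^sub>E a\<in>carrier G. grade a) \<and>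
    finite {a \<in> carrier G. f' a \<noteq> \<zero>} \<and> comb g = (\<Oplus>a\<in>{a \<in> carrier G. f' a \<noteq> \<zero>}. f' a)" for f'
  have P: "P (F h)" if "comb h = comb g" for h
    unfolding P_def
  proof (intro conjI)
    have "c \<odot> v a \<in> grade a" if "a \<in> carrier G" for a c
      using grade_subspace[OF that] v_grade[OF that] by (auto simp: subspace_def submodule_def)
    then show "F h \<in> (\<Pi>\<^sub>E a\<in>carrier G. grade a)" by (auto simp: F_def)
    show "finite {a \<in> carrier G. F h a \<noteq> \<zero>}" using finite_G by simp
    have "comb h = (\<Oplus>a\<in>{a \<in> carrier G. F h a \<noteq> \<zero>}. F h a)"
      unfolding comb_on_def
      by (rule M.add.finprod_mono_neutral_cong_right) (use finite_G in \<open>auto simp: F_def\<close>)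
    then show "comb g = (\<Oplus>a\<in>{a \<in> carrier G. F h a \<noteq> \<zero>}. F h a)" using that by simp
  qed
  have "\<exists>!f'. P f'"
    unfolding P_def by (rule direct_sum_decomposition) simp
  moreover have "P (F f)" "P (F g)" using P eq by auto
  ultimately have "F f = F g" by (elim ex1E) blast
  then have "F f a = F g a" by simp
  then have "f a \<odot> v a = g a \<odot> v a" using a by (simp add: F_def)
  then show ?thesis using a v_nonzero by (intro smult_cancel) auto
qed

lemma comb_surj:
  assumes "w \<in> carrier W"
  obtains f where "w = comb f"
proof -
  \<comment> \<open>A linear combination over the set of basis vectors becomes a sum over G only if
    v has no repetitions.\<close>
  have "inj_on v (carrier G)"
  proof (rule inj_onI)
    fix a b assume a: "a \<in> carrier G" and b: "b \<in> carrier G" and "v a = v b"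
    then have "comb (\<lambda>x. if x = a then 1 else 0) = comb (\<lambda>x. if x = b then 1 else 0)"
      by (simp add: comb_single)
    from comb_inj[OF this a] show "a = b" by (simp split: if_splits)
  qed
  have sub: "v ` carrier G \<subseteq> carrier W" by auto
  have "w \<in> span (v ` carrier G)" using assms v_basis by (simp add: basis_def)
  then obtain c where "w = lincomb c (v ` carrier G)"
    using finite_span[OF _ sub] finite_G by auto
  also have "\<dots> = comb (\<lambda>a. c (v a))"
    unfolding lincomb_def comb_on_def using \<open>inj_on v (carrier G)\<close>
    by (intro M.finsum_reindex) auto
  finally show ?thesis by (rule that)
qed

text \<open>Twisted convolution: the coefficient of v_c in a product collects the pairs (a, b) with
  ab = c, that is b = a^-1 c, weighted by C(a, b).\<close>

definition conv :: "('g \<Rightarrow> complex) \<Rightarrow> ('g \<Rightarrow> complex) \<Rightarrow> 'g \<Rightarrow> complex" where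
  "conv f g c = (\<Sum>a\<in>carrier G. f a * (C a (inv\<^bsub>G\<^esub> a \<otimes>\<^bsub>G\<^esub> c) * g (inv\<^bsub>G\<^esub> a \<otimes>\<^bsub>G\<^esub> c)))"

lemma v_mult_comb:
  assumes a: "a \<in> carrier G"
  shows "v a \<otimes> comb g = comb (\<lambda>c. C a (inv\<^bsub>G\<^esub> a \<otimes>\<^bsub>G\<^esub> c) * g (inv\<^bsub>G\<^esub> a \<otimes>\<^bsub>G\<^esub> c))"
proof -
  have v_zero: "v a \<otimes> \<zero> = \<zero>"
    using mult_smult_right[of "v a" \<zero> 0] a mult_closed[of "v a" \<zero>]
    by (simp add: smult_zero_vector smult_zero_scalar)
  have "v a \<otimes> comb_on S g = (\<Oplus>b\<in>S. (C a b * g b) \<odot> v (a \<otimes>\<^bsub>G\<^esub> b))"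
    if "finite S" "S \<subseteq> carrier G" for S
    using that
  proof (induction rule: finite_induct)
    case (insert b S)
    have "v a \<otimes> comb_on (insert b S) g = v a \<otimes> (g b \<odot> v b) \<oplus> v a \<otimes> comb_on S g"
      using insert a by (simp add: comb_on_insert mult_add_right)
    also have "v a \<otimes> (g b \<odot> v b) = (C a b * g b) \<odot> v (a \<otimes>\<^bsub>G\<^esub> b)"
      using insert a by (simp add: mult_smult_right v_mult smult_smult mult.commute)
    also have "v a \<otimes> comb_on S g = (\<Oplus>b\<in>S. (C a b * g b) \<odot> v (a \<otimes>\<^bsub>G\<^esub> b))"
      using insert by simp
    finally show ?case
      using insert a by (subst M.finsum_insert) auto
  qed (simp add: v_zero)
  then have "v a \<otimes> comb g = (\<Oplus>b\<in>carrier G. (C a b * g b) \<odot> v (a \<otimes>\<^bsub>G\<^esub> b))"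
    using finite_G by simp
  \<comment> \<open>Writing b as a^-1 (ab) makes the summand a function of ab alone, ready for the
    change of variable c = ab.\<close>
  also have "\<dots> = (\<Oplus>b\<in>carrier G. (C a (inv\<^bsub>G\<^esub> a \<otimes>\<^bsub>G\<^esub> (a \<otimes>\<^bsub>G\<^esub> b)) * g (inv\<^bsub>G\<^esub> a \<otimes>\<^bsub>G\<^esub> (a \<otimes>\<^bsub>G\<^esub> b))) \<odot> v (a \<otimes>\<^bsub>G\<^esub> b))"
    using a by (intro M.finsum_cong') (auto simp: G.m_assoc[symmetric])
  also have "\<dots> = comb (\<lambda>c. C a (inv\<^bsub>G\<^esub> a \<otimes>\<^bsub>G\<^esub> c) * g (inv\<^bsub>G\<^esub> a \<otimes>\<^bsub>G\<^esub> c))"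
    using tc.bij_betw_left_translation[OF a] a unfolding comb_on_def bij_betw_def
    by (subst M.finsum_reindex[of _ "\<lambda>b. a \<otimes>\<^bsub>G\<^esub> b" "carrier G", symmetric]) auto
  finally show ?thesis .
qed

lemma comb_mult: "comb f \<otimes> comb g = comb (conv f g)"
proof -
  have zero_mult: "\<zero> \<otimes> comb g = \<zero>"
    using mult_smult_left[of \<zero> "comb g" 0] mult_closed[of \<zero> "comb g"]
    by (simp add: smult_zero_vector smult_zero_scalar)
  let ?h = "\<lambda>a c. C a (inv\<^bsub>G\<^esub> a \<otimes>\<^bsub>G\<^esub> c) * g (inv\<^bsub>G\<^esub> a \<otimes>\<^bsub>G\<^esub> c)"
  have "comb_on S f \<otimes> comb g = comb (\<lambda>c. \<Sum>a\<in>S. f a * ?h a c)"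
    if "finite S" "S \<subseteq> carrier G" for S
    using that
  proof (induction rule: finite_induct)
    case empty
    have "comb (\<lambda>c. 0 * 0) = 0 \<odot> comb (\<lambda>c. 0)"
      using finite_G by (rule comb_on_smult) simp
    then show ?case by (simp add: zero_mult smult_zero_scalar)
  next
    case (insert a S)
    have "comb_on (insert a S) f \<otimes> comb g = (f a \<odot> v a) \<otimes> comb g \<oplus> comb_on S f \<otimes> comb g"
      using insert by (simp add: comb_on_insert mult_add_left)
    also have "(f a \<odot> v a) \<otimes> comb g = comb (\<lambda>c. f a * ?h a c)"
      using insert finite_G by (simp add: mult_smult_left v_mult_comb comb_on_smult)
    also have "comb_on S f \<otimes> comb g = comb (\<lambda>c. \<Sum>a\<in>S. f a * ?h a c)"
      using insert by simp
    also have "comb (\<lambda>c. f a * ?h a c) \<oplus> comb (\<lambda>c. \<Sum>a\<in>S. f a * ?h a c)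
        = comb (\<lambda>c. f a * ?h a c + (\<Sum>a\<in>S. f a * ?h a c))"
      by (rule comb_add[symmetric])
    finally show ?case using insert by simp
  qed
  from this[of "carrier G"] show ?thesis using finite_G by (simp add: conv_def[abs_def])
qed

text \<open>The substitution c = ab pairs each twist C(a, b) with \<pi>(ab), which together are
  \<pi>(a) \<pi>(b); the double sum then factors.\<close>

lemma rep_eval_conv:
  assumes \<pi>: "tc.proj_rep n \<pi>"
  shows "tc.rep_eval n \<pi> (conv f g) = tc.rep_eval n \<pi> f * tc.rep_eval n \<pi> g"
proof -
  let ?h = "\<lambda>a c. C a (inv\<^bsub>G\<^esub> a \<otimes>\<^bsub>G\<^esub> c) * g (inv\<^bsub>G\<^esub> a \<otimes>\<^bsub>G\<^esub> c)"
  have h: "tc.rep_eval n \<pi> (?h a) = \<pi> a * tc.rep_eval n \<pi> g" if a: "a \<in> carrier G" for a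
  proof -
    have "tc.rep_eval n \<pi> (?h a)
        = mat_sum n n (\<lambda>b. ?h a (a \<otimes>\<^bsub>G\<^esub> b) \<cdot>\<^sub>m \<pi> (a \<otimes>\<^bsub>G\<^esub> b)) (carrier G)"
      unfolding tc.rep_eval_def by (rule mat_sum_reindex[OF tc.bij_betw_left_translation[OF a]])
    also have "\<dots> = mat_sum n n (\<lambda>b. g b \<cdot>\<^sub>m (\<pi> a * \<pi> b)) (carrier G)"
      using a by (intro mat_sum_cong)
        (simp add: G.m_assoc[symmetric] tc.proj_rep_mult[OF \<pi>] smult_smult_mat mult.commute)
    also have "\<dots> = \<pi> a * tc.rep_eval n \<pi> g"
      by (rule tc.mult_rep_eval_left[OF \<pi> tc.proj_rep_carrier[OF \<pi> a], symmetric])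
    finally show ?thesis .
  qed
  have "tc.rep_eval n \<pi> (conv f g) = mat_sum n n (\<lambda>a. f a \<cdot>\<^sub>m tc.rep_eval n \<pi> (?h a)) (carrier G)"
  proof (rule eq_matI)
    fix i j assume "i < dim_row (mat_sum n n (\<lambda>a. f a \<cdot>\<^sub>m tc.rep_eval n \<pi> (?h a)) (carrier G))"
      "j < dim_col (mat_sum n n (\<lambda>a. f a \<cdot>\<^sub>m tc.rep_eval n \<pi> (?h a)) (carrier G))"
    then have ij: "i < n" "j < n" by (auto simp: mat_sum_def)
    have "tc.rep_eval n \<pi> (conv f g) $$ (i, j)
        = (\<Sum>c\<in>carrier G. \<Sum>a\<in>carrier G. f a * (?h a c * \<pi> c $$ (i, j)))"
      using ij by (simp add: tc.rep_eval_index[OF \<pi>] conv_def sum_distrib_right mult.assoc)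
    also have "\<dots> = (\<Sum>a\<in>carrier G. f a * (\<Sum>c\<in>carrier G. ?h a c * \<pi> c $$ (i, j)))"
      unfolding sum_distrib_left by (rule sum.swap)
    also have "\<dots> = mat_sum n n (\<lambda>a. f a \<cdot>\<^sub>m tc.rep_eval n \<pi> (?h a)) (carrier G) $$ (i, j)"
      using ij by (simp add: mat_sum_index tc.rep_eval_index[OF \<pi>] carrier_matD[OF tc.rep_eval_carrier])
    finally show "tc.rep_eval n \<pi> (conv f g) $$ (i, j)
      = mat_sum n n (\<lambda>a. f a \<cdot>\<^sub>m tc.rep_eval n \<pi> (?h a)) (carrier G) $$ (i, j)" .
  qed (simp_all add: carrier_matD[OF tc.rep_eval_carrier] carrier_matD[OF mat_sum_carrier])
  also have "\<dots> = mat_sum n n (\<lambda>a. f a \<cdot>\<^sub>m (\<pi> a * tc.rep_eval n \<pi> g)) (carrier G)"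
    by (intro mat_sum_cong) (simp add: h)
  also have "\<dots> = tc.rep_eval n \<pi> f * tc.rep_eval n \<pi> g"
    by (rule tc.mult_rep_eval_right[OF \<pi> tc.rep_eval_carrier, symmetric])
  finally show ?thesis .
qed

lemma algebra_isomorphic_matrix_product:
  assumes fam: "tc.irred_family m n \<pi>"
    and complete: "\<And>k \<sigma>. tc.irred k \<sigma> \<Longrightarrow> \<exists>i<m. tc.proj_rep_isomorphic k \<sigma> (n i) (\<pi> i)"
  shows "algebra_isomorphic W (product_algebra {..<m} (\<lambda>i. matrix_algebra (n i)))"
proof -
  let ?P = "product_algebra {..<m} (\<lambda>i. matrix_algebra (n i))"
  have irr: "tc.irred (n i) (\<pi> i)" if "i < m" for i using fam that by (simp add: tc.irred_family_def)
  have rep: "tc.proj_rep (n i) (\<pi> i)" if "i < m" for i using irr[OF that] by (simp add: tc.irred_def)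
  \<comment> \<open>The chosen coefficients are determined only on the carrier of G. Evaluation
    looks no further, so \<open>\<phi>\<close> may be computed from any representing
    function.\<close>
  define coord where "coord w = (SOME f. w = comb f)" for w
  define \<phi> where "\<phi> w = (\<lambda>i\<in>{..<m}. tc.rep_eval (n i) (\<pi> i) (coord w))" for w
  have comb_coord: "comb (coord w) = w" if w: "w \<in> carrier W" for w
  proof -
    have "\<exists>f. w = comb f" using comb_surj[OF w] by blast
    then show ?thesis unfolding coord_def by (metis (mono_tags, lifting) someI_ex)
  qed
  have \<phi>_comb: "\<phi> (comb f) = (\<lambda>i\<in>{..<m}. tc.rep_eval (n i) (\<pi> i) f)" for f
  proof -
    have "coord (comb f) a = f a" if "a \<in> carrier G" for a
      using comb_inj[OF _ that] comb_coord[of "comb f"] by simp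
    then show ?thesis
      unfolding \<phi>_def by (intro restrict_ext tc.rep_eval_cong)
  qed
  have "\<phi> \<in> Ring.ring_hom W ?P"
  proof (rule ring_hom_memI)
    fix x y assume "x \<in> carrier W" "y \<in> carrier W"
    then obtain f g where f: "x = comb f" and g: "y = comb g" using comb_surj by metis
    show "\<phi> x \<in> carrier ?P"
      by (simp add: f \<phi>_comb product_algebra_def module_mat_simps)
    show "\<phi> (x \<otimes> y) = \<phi> x \<otimes>\<^bsub>?P\<^esub> \<phi> y"
      unfolding f g comb_mult \<phi>_comb
      by (auto simp: product_algebra_def module_mat_simps rep_eval_conv[OF rep] intro!: restrict_ext)
    show "\<phi> (x \<oplus> y) = \<phi> x \<oplus>\<^bsub>?P\<^esub> \<phi> y"
      unfolding f g comb_add[symmetric] \<phi>_comb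
      by (auto simp: product_algebra_def module_mat_simps tc.rep_eval_add[OF rep] intro!: restrict_ext)
  next
    let ?d = "\<lambda>b. if b = \<one>\<^bsub>G\<^esub> then 1 else (0 :: complex)"
    have one: "\<one> = comb ?d" by (simp add: comb_single one_smult flip: v_one)
    have "tc.rep_eval (n i) (\<pi> i) ?d = 1\<^sub>m (n i)" if i: "i < m" for i
    proof (rule eq_matI)
      fix r q assume "r < dim_row (1\<^sub>m (n i) :: complex mat)" "q < dim_col (1\<^sub>m (n i) :: complex mat)"
      then have rq: "r < n i" "q < n i" by auto
      have "tc.rep_eval (n i) (\<pi> i) ?d $$ (r, q)
          = (\<Sum>a\<in>carrier G. if a = \<one>\<^bsub>G\<^esub> then \<pi> i a $$ (r, q) else 0)"
        unfolding tc.rep_eval_index[OF rep[OF i] rq] by (intro sum.cong) auto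
      also have "\<dots> = \<pi> i \<one>\<^bsub>G\<^esub> $$ (r, q)" using finite_G by simp
      finally show "tc.rep_eval (n i) (\<pi> i) ?d $$ (r, q) = 1\<^sub>m (n i) $$ (r, q)"
        using rep[OF i] by (simp add: tc.proj_rep_def)
    qed (simp_all add: carrier_matD[OF tc.rep_eval_carrier])
    then show "\<phi> \<one> = \<one>\<^bsub>?P\<^esub>"
      unfolding one \<phi>_comb by (auto simp: product_algebra_def module_mat_simps intro!: restrict_ext)
  qed
  moreover have "bij_betw \<phi> (carrier W) (carrier ?P)"
    unfolding bij_betw_def
  proof (intro conjI inj_onI equalityI subsetI)
    fix x y assume "x \<in> carrier W" "y \<in> carrier W" and eq: "\<phi> x = \<phi> y"
    then obtain f g where f: "x = comb f" and g: "y = comb g" using comb_surj by metis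
    have eq': "tc.rep_eval (n i) (\<pi> i) f = tc.rep_eval (n i) (\<pi> i) g" if "i < m" for i
      using fun_cong[OF eq[unfolded f g \<phi>_comb], of i] that by simp
    \<comment> \<open>The kernel statement is applied to the difference, in a form to which
      additivity and homogeneity of the evaluation apply.\<close>
    have "tc.rep_eval (n i) (\<pi> i) (\<lambda>a. f a + (-1) * g a) = 0\<^sub>m (n i) (n i)" if i: "i < m" for i
      unfolding tc.rep_eval_add[OF rep[OF i]] tc.rep_eval_smult[OF rep[OF i]] eq'[OF i]
      by (rule eq_matI) (simp_all add: carrier_matD[OF tc.rep_eval_carrier])
    from tc.rep_eval_family_inj[OF irr complete this] have "f a = g a" if "a \<in> carrier G" for a
      using that by fastforce
    then show "x = y" unfolding f g by (intro comb_on_cong) auto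
  next
    fix M assume "M \<in> \<phi> ` carrier W"
    then show "M \<in> carrier ?P"
      using \<open>\<phi> \<in> Ring.ring_hom W ?P\<close> by (auto simp: Ring.ring_hom_def)
  next
    fix M assume M: "M \<in> carrier ?P"
    have "\<phi> (comb (tc.fourier_inv m n \<pi> M)) = M"
    proof
      fix i
      show "\<phi> (comb (tc.fourier_inv m n \<pi> M)) i = M i"
        unfolding \<phi>_comb using M tc.rep_eval_fourier_inv[OF fam, of i M]
        by (cases "i < m") (auto simp: product_algebra_def module_mat_simps PiE_iff extensional_def)
    qed
    then show "M \<in> \<phi> ` carrier W" by (metis comb_on_closed image_eqI subset_refl)
  qed
  moreover have "\<phi> (c \<odot> x) = c \<odot>\<^bsub>?P\<^esub> \<phi> x" if x: "x \<in> carrier W" for c x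
  proof -
    obtain f where f: "x = comb f" using comb_surj[OF x] by blast
    show ?thesis
      unfolding f comb_on_smult[OF finite_G subset_refl, symmetric] \<phi>_comb
      by (auto simp: product_algebra_def module_mat_simps tc.rep_eval_smult[OF rep] intro!: restrict_ext)
  qed
  ultimately show ?thesis
    unfolding algebra_isomorphic_def ring_iso_def by blast
qed

end

subsection \<open>Commutativity\<close>

lemma algebra_isomorphic_trans:
  assumes "algebra_isomorphic V W" "algebra_isomorphic W U"
  shows "algebra_isomorphic V U"
proof -
  from assms obtain f g where f: "f \<in> ring_iso V W"
    and fs: "\<And>c x. x \<in> carrier V \<Longrightarrow> f (c \<odot>\<^bsub>V\<^esub> x) = c \<odot>\<^bsub>W\<^esub> f x"
    and g: "g \<in> ring_iso W U"
    and gs: "\<And>c x. x \<in> carrier W \<Longrightarrow> g (c \<odot>\<^bsub>W\<^esub> x) = c \<odot>\<^bsub>U\<^esub> g x"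
    unfolding algebra_isomorphic_def by blast
  have "f x \<in> carrier W" if "x \<in> carrier V" for x
    using f that by (auto simp: ring_iso_def Ring.ring_hom_def)
  then have "\<forall>c. \<forall>x \<in> carrier V. (g \<circ> f) (c \<odot>\<^bsub>V\<^esub> x) = c \<odot>\<^bsub>U\<^esub> (g \<circ> f) x"
    by (simp add: fs gs)
  then show ?thesis
    unfolding algebra_isomorphic_def using ring_iso_set_trans[OF f g] by blast
qed

lemma algebra_isomorphic_commutative_iff:
  assumes iso: "algebra_isomorphic V W"
    and closed: "\<And>x y. \<lbrakk>x \<in> carrier V; y \<in> carrier V\<rbrakk> \<Longrightarrow> x \<otimes>\<^bsub>V\<^esub> y \<in> carrier V"
  shows "(\<forall>x \<in> carrier V. \<forall>y \<in> carrier V. x \<otimes>\<^bsub>V\<^esub> y = y \<otimes>\<^bsub>V\<^esub> x) \<longleftrightarrow>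
    (\<forall>x \<in> carrier W. \<forall>y \<in> carrier W. x \<otimes>\<^bsub>W\<^esub> y = y \<otimes>\<^bsub>W\<^esub> x)"
proof -
  from iso obtain f where f: "f \<in> ring_iso V W" unfolding algebra_isomorphic_def by blast
  have inj: "inj_on f (carrier V)" and img: "f ` carrier V = carrier W"
    using f by (auto simp: ring_iso_def bij_betw_def)
  have mult: "f (x \<otimes>\<^bsub>V\<^esub> y) = f x \<otimes>\<^bsub>W\<^esub> f y" if "x \<in> carrier V" "y \<in> carrier V" for x y
    using f that by (auto simp: ring_iso_def Ring.ring_hom_def)
  have "x \<otimes>\<^bsub>V\<^esub> y = y \<otimes>\<^bsub>V\<^esub> x \<longleftrightarrow> f x \<otimes>\<^bsub>W\<^esub> f y = f y \<otimes>\<^bsub>W\<^esub> f x"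
    if "x \<in> carrier V" "y \<in> carrier V" for x y
    using inj_on_eq_iff[OF inj closed[OF that] closed[OF that(2,1)]] mult that by simp
  then show ?thesis unfolding img[symmetric] by simp
qed

text \<open>In a block of size at least 2 the products of the matrix units at (0, 1) and (1, 0)
  differ at entry (0, 0) according to the order. Positivity of the sizes matters, because a block of
  size 0 is commutative too.\<close>

lemma matrix_product_commutative_iff:
  assumes n: "\<And>i. i < m \<Longrightarrow> 0 < n i"
  defines "P \<equiv> product_algebra {..<m :: nat} (\<lambda>i. matrix_algebra (n i))"
  shows "(\<forall>x \<in> carrier P. \<forall>y \<in> carrier P. x \<otimes>\<^bsub>P\<^esub> y = y \<otimes>\<^bsub>P\<^esub> x) \<longleftrightarrow> (\<forall>i<m. n i = 1)"
proof
  assume comm: "\<forall>x \<in> carrier P. \<forall>y \<in> carrier P. x \<otimes>\<^bsub>P\<^esub> y = y \<otimes>\<^bsub>P\<^esub> x"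
  show "\<forall>i<m. n i = 1"
  proof (intro allI impI)
    fix i assume i: "i < m"
    show "n i = 1"
    proof (rule ccontr)
      assume "n i \<noteq> 1"
      with n[OF i] have ni: "1 < n i" by simp
      define E where "E p q j = mat (n j) (n j) (\<lambda>(r, s). if r = p \<and> s = q then 1 else (0 :: complex))"
        for p q j
      \<comment> \<open>The same matrix unit is placed in every block, giving zero where the block
        is too small; only block i is inspected.\<close>
      define x where "x p q = (\<lambda>j\<in>{..<m}. E p q j)" for p q
      have "x p q \<in> carrier P" for p q
        by (simp add: P_def product_algebra_def module_mat_simps x_def E_def)
      with comm have "x 0 1 \<otimes>\<^bsub>P\<^esub> x 1 0 = x 1 0 \<otimes>\<^bsub>P\<^esub> x 0 1" by blast
      then have eq: "E 0 1 i * E 1 0 i = E 1 0 i * E 0 1 i"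
        using i by (auto simp: P_def product_algebra_def module_mat_simps x_def dest!: fun_cong[of _ _ i])
      have E: "E p q i \<in> carrier_mat (n i) (n i)" for p q by (simp add: E_def)
      have "(E 0 1 i * E 1 0 i) $$ (0, 0) = (\<Sum>k<n i. E 0 1 i $$ (0, k) * E 1 0 i $$ (k, 0))"
        using ni by (intro index_mult_mat_sum[OF E E]) simp_all
      also have "\<dots> = (\<Sum>k<n i. if k = 1 then 1 else 0)"
        using ni by (intro sum.cong refl) (simp add: E_def)
      also have "\<dots> = 1" using ni by simp
      finally have "(E 0 1 i * E 1 0 i) $$ (0, 0) = 1" .
      moreover have "(E 1 0 i * E 0 1 i) $$ (0, 0) = 0"
        using ni by (subst index_mult_mat_sum[OF E E]) (auto simp: E_def intro!: sum.neutral)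
      ultimately show False using eq by simp
    qed
  qed
next
  assume n1: "\<forall>i<m. n i = 1"
  have "A * B = B * A" if A: "A \<in> carrier_mat 1 1" and B: "B \<in> carrier_mat 1 1" for A B :: "complex mat"
    using A B by (intro eq_matI) (auto simp: scalar_prod_def mult.commute)
  then show "\<forall>x \<in> carrier P. \<forall>y \<in> carrier P. x \<otimes>\<^bsub>P\<^esub> y = y \<otimes>\<^bsub>P\<^esub> x"
    using n1 by (auto simp: P_def product_algebra_def module_mat_simps PiE_iff intro!: restrict_ext)
qed

lemma matrix_product_isomorphic_scalar_product:
  assumes n1: "\<And>i. i < m \<Longrightarrow> n i = (1 :: nat)"
  shows "algebra_isomorphic (product_algebra {..<m :: nat} (\<lambda>i. matrix_algebra (n i)))
    (product_algebra {..<m} (\<lambda>_. scalar_algebra))"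
proof -
  let ?P = "product_algebra {..<m} (\<lambda>i. matrix_algebra (n i))"
  let ?S = "product_algebra {..<m} (\<lambda>_. scalar_algebra)"
  note simps = product_algebra_def module_mat_simps scalar_algebra_def
  define f where "f x = (\<lambda>i\<in>{..<m}. x i $$ (0, 0))" for x :: "nat \<Rightarrow> complex mat"
  have c: "x i \<in> carrier_mat 1 1" if "x \<in> carrier ?P" "i < m" for x i
    using that n1 by (auto simp: simps PiE_iff)
  have "f \<in> Ring.ring_hom ?P ?S"
  proof (rule ring_hom_memI)
    fix x y assume x: "x \<in> carrier ?P" and y: "y \<in> carrier ?P"
    show "f x \<in> carrier ?S" by (simp add: simps f_def)
    have "(x i * y i) $$ (0, 0) = x i $$ (0, 0) * y i $$ (0, 0)" if "i < m" for i
      using c[OF x that] c[OF y that] by (simp add: scalar_prod_def)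
    then show "f (x \<otimes>\<^bsub>?P\<^esub> y) = f x \<otimes>\<^bsub>?S\<^esub> f y"
      by (auto simp: simps f_def intro!: restrict_ext)
    have "(x i + y i) $$ (0, 0) = x i $$ (0, 0) + y i $$ (0, 0)" if "i < m" for i
      using c[OF x that] c[OF y that] by simp
    then show "f (x \<oplus>\<^bsub>?P\<^esub> y) = f x \<oplus>\<^bsub>?S\<^esub> f y"
      by (auto simp: simps f_def intro!: restrict_ext)
  next
    show "f \<one>\<^bsub>?P\<^esub> = \<one>\<^bsub>?S\<^esub>"
      using n1 by (auto simp: simps f_def intro!: restrict_ext)
  qed
  moreover have "bij_betw f (carrier ?P) (carrier ?S)"
  proof (rule bij_betwI[where g = "\<lambda>z. \<lambda>i\<in>{..<m}. mat 1 1 (\<lambda>_. z i)"])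
    show "f \<in> carrier ?P \<rightarrow> carrier ?S" by (simp add: simps f_def)
    show "(\<lambda>z. \<lambda>i\<in>{..<m}. mat 1 1 (\<lambda>_. z i)) \<in> carrier ?S \<rightarrow> carrier ?P"
      using n1 by (auto simp: simps)
    show "(\<lambda>i\<in>{..<m}. mat 1 1 (\<lambda>_. f x i)) = x" if x: "x \<in> carrier ?P" for x
    proof
      fix i
      show "(\<lambda>i\<in>{..<m}. mat 1 1 (\<lambda>_. f x i)) i = x i"
      proof (cases "i < m")
        case True
        then show ?thesis using c[OF x True] by (auto simp: f_def intro!: eq_matI)
      next
        case False
        then show ?thesis using x by (auto simp: simps PiE_iff extensional_def)
      qed
    qed
    show "f (\<lambda>i\<in>{..<m}. mat 1 1 (\<lambda>_. z i)) = z" if "z \<in> carrier ?S" for z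
      using that by (auto simp: simps f_def PiE_iff extensional_def)
  qed
  moreover have "f (k \<odot>\<^bsub>?P\<^esub> x) = k \<odot>\<^bsub>?S\<^esub> f x" if x: "x \<in> carrier ?P" for k x
  proof -
    have "(k \<cdot>\<^sub>m x i) $$ (0, 0) = k * x i $$ (0, 0)" if "i < m" for i
      using c[OF x that] by simp
    then show ?thesis by (auto simp: simps f_def intro!: restrict_ext)
  qed
  ultimately show ?thesis unfolding algebra_isomorphic_def ring_iso_def by blast
qed

subsection \<open>Representations of the twisted product group\<close>

context twisted_cocycle
begin

text \<open>The restriction to vectors of length n is there because elements of \<open>Bij\<close>
  must be undefined outside their set.\<close>

definition lifted_rep ::
  "nat \<Rightarrow> ('g \<Rightarrow> complex mat) \<Rightarrow> complex \<times> 'g \<Rightarrow> complex vec \<Rightarrow> complex vec" where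
  "lifted_rep n \<pi> = (\<lambda>(\<alpha>, a). \<lambda>x\<in>carrier_vec n. \<alpha> \<cdot>\<^sub>v (\<pi> a *\<^sub>v x))"

lemma lifted_rep_apply: "x \<in> carrier_vec n \<Longrightarrow> lifted_rep n \<pi> (\<alpha>, a) x = \<alpha> \<cdot>\<^sub>v (\<pi> a *\<^sub>v x)"
  by (simp add: lifted_rep_def)

text \<open>The first coordinate of a product carries the C(a, b) of the projective law, so the
  action is multiplicative; nonzero scalars keep it bijective. Subspaces invariant under all (1, a)
  are invariant under \<pi>, so irreducibility is inherited.\<close>

lemma irreducible_lifted_rep:
  assumes \<pi>: "irred n \<pi>" and H: "group (twisted_product A C G)"
    and A0: "0 \<notin> A" and A1: "1 \<in> A"
  shows "irreducible_representation (twisted_product A C G) (module_vec TYPE(complex) n) (lifted_rep n \<pi>)"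
proof -
  let ?H = "twisted_product A C G" and ?V = "module_vec TYPE(complex) n"
  have rep: "proj_rep n \<pi>" and n: "0 < n" using \<pi> by (auto simp: irred_def)
  note pc = proj_rep_carrier[OF rep]
  have pv: "\<pi> a *\<^sub>v x \<in> carrier_vec n" if "a \<in> carrier G" "x \<in> carrier_vec n" for a x
    using pc[OF that(1)] that(2) by simp
  have bij: "lifted_rep n \<pi> (\<alpha>, a) \<in> Bij (carrier_vec n)" if \<alpha>: "\<alpha> \<in> A" and a: "a \<in> carrier G" for \<alpha> a
  proof -
    have \<alpha>0: "\<alpha> \<noteq> 0" using A0 \<alpha> by auto
    note ic = rep_inv_carrier[OF rep a]
    have "bij_betw (lifted_rep n \<pi> (\<alpha>, a)) (carrier_vec n) (carrier_vec n)"
    proof (rule bij_betwI[where g = "\<lambda>x. inverse \<alpha> \<cdot>\<^sub>v (rep_inv \<pi> a *\<^sub>v x)"])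
      fix x :: "complex vec" assume x: "x \<in> carrier_vec n"
      have "rep_inv \<pi> a *\<^sub>v (\<pi> a *\<^sub>v x) = x"
        using assoc_mult_mat_vec[OF ic pc[OF a] x] rep_inv_left[OF rep a] x by simp
      then show "inverse \<alpha> \<cdot>\<^sub>v (rep_inv \<pi> a *\<^sub>v lifted_rep n \<pi> (\<alpha>, a) x) = x"
        using x \<alpha>0 by (simp add: lifted_rep_apply mult_mat_vec[OF ic pv[OF a x]] smult_smult_assoc)
      have y: "rep_inv \<pi> a *\<^sub>v x \<in> carrier_vec n" using ic x by simp
      have "\<pi> a *\<^sub>v (rep_inv \<pi> a *\<^sub>v x) = x"
        using assoc_mult_mat_vec[OF pc[OF a] ic x] rep_inv_right[OF rep a] x by simp
      then show "lifted_rep n \<pi> (\<alpha>, a) (inverse \<alpha> \<cdot>\<^sub>v (rep_inv \<pi> a *\<^sub>v x)) = x"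
        using x y \<alpha>0 by (simp add: lifted_rep_apply mult_mat_vec[OF pc[OF a] y] smult_smult_assoc)
    qed (use pv[OF a] ic in \<open>auto simp: lifted_rep_apply\<close>)
    then show ?thesis by (simp add: Bij_def lifted_rep_def)
  qed
  have "lifted_rep n \<pi> \<in> hom ?H (BijGroup (carrier_vec n))"
  proof (rule homI)
    fix h assume "h \<in> carrier ?H"
    then show "lifted_rep n \<pi> h \<in> carrier (BijGroup (carrier_vec n))"
      using bij by (auto simp: twisted_product_def BijGroup_def)
  next
    fix h k assume "h \<in> carrier ?H" "k \<in> carrier ?H"
    then obtain \<alpha> a \<beta> b where h: "h = (\<alpha>, a)" "\<alpha> \<in> A" "a \<in> carrier G"
      and k: "k = (\<beta>, b)" "\<beta> \<in> A" "b \<in> carrier G"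
      by (auto simp: twisted_product_def)
    have "lifted_rep n \<pi> (\<alpha> * \<beta> * C a b, a \<otimes> b)
        = compose (carrier_vec n) (lifted_rep n \<pi> (\<alpha>, a)) (lifted_rep n \<pi> (\<beta>, b))"
    proof
      fix x
      show "lifted_rep n \<pi> (\<alpha> * \<beta> * C a b, a \<otimes> b) x
        = compose (carrier_vec n) (lifted_rep n \<pi> (\<alpha>, a)) (lifted_rep n \<pi> (\<beta>, b)) x"
      proof (cases "x \<in> carrier_vec n")
        case True
        have "\<pi> a *\<^sub>v (\<pi> b *\<^sub>v x) = C a b \<cdot>\<^sub>v (\<pi> (a \<otimes> b) *\<^sub>v x)"
          using assoc_mult_mat_vec[OF pc[OF h(3)] pc[OF k(3)] True] proj_rep_mult[OF rep h(3) k(3)]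
            smult_mat_mult_vec[OF pc True, of "a \<otimes> b"] h(3) k(3) by simp
        then show ?thesis
          using True pv[OF k(3) True]
          by (simp add: compose_def lifted_rep_apply mult_mat_vec[OF pc[OF h(3)]] smult_smult_assoc mult.assoc)
      qed (simp add: compose_def lifted_rep_def)
    qed
    then show "lifted_rep n \<pi> (h \<otimes>\<^bsub>?H\<^esub> k) =
        lifted_rep n \<pi> h \<otimes>\<^bsub>BijGroup (carrier_vec n)\<^esub> lifted_rep n \<pi> k"
      using h k bij by (simp add: twisted_product_def BijGroup_def)
  qed
  then have "group_action ?H (carrier_vec n) (lifted_rep n \<pi>)"
    using H group_BijGroup by (simp add: group_action_def group_hom_def group_hom_axioms_def)
  moreover have "linear_map complex_field ?V ?V (lifted_rep n \<pi> h)" if "h \<in> carrier ?H" for h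
  proof -
    obtain \<alpha> a where h: "h = (\<alpha>, a)" "a \<in> carrier G" using \<open>h \<in> carrier ?H\<close>
      by (auto simp: twisted_product_def)
    have "lifted_rep n \<pi> h \<in> module_hom complex_field ?V ?V"
      unfolding module_hom_def using pv[OF h(2)] pc[OF h(2)]
      by (auto simp: h(1) module_vec_simps lifted_rep_apply mult_add_distrib_mat_vec mult_mat_vec
        smult_add_distrib_vec[of _ n] smult_smult_assoc mult.commute)
    then show ?thesis
      using vec_vs[of n] vec_module[of n]
      by (simp add: linear_map_def mod_hom_def mod_hom_axioms_def)
  qed
  ultimately have "representation ?H ?V (lifted_rep n \<pi>)"
    using vec_vs by (simp add: representation_def representation_axioms_def module_vec_simps)
  moreover have "carrier ?V \<noteq> {\<zero>\<^bsub>?V\<^esub>}"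
  proof -
    have "unit_vec n 0 \<in> carrier_vec n" "unit_vec n 0 \<noteq> (0\<^sub>v n :: complex vec)"
      using n by (simp_all add: unit_vec_nonzero)
    then show ?thesis unfolding module_vec_simps by blast
  qed
  moreover have "U = {\<zero>\<^bsub>?V\<^esub>} \<or> U = carrier ?V"
    if U: "subspace complex_field U ?V" and inv: "\<forall>h \<in> carrier ?H. \<forall>x \<in> U. lifted_rep n \<pi> h x \<in> U" for U
  proof -
    have Un: "U \<subseteq> carrier_vec n" using U by (simp add: subspace_module_vec_iff)
    have "\<pi> a *\<^sub>v x \<in> U" if a: "a \<in> carrier G" and x: "x \<in> U" for a x
    proof -
      have "lifted_rep n \<pi> (1, a) x \<in> U" using inv a x A1 by (auto simp: twisted_product_def)
      then show ?thesis using x Un by (auto simp: lifted_rep_apply)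
    qed
    then show ?thesis using \<pi> U unfolding irred_def module_vec_simps by blast
  qed
  ultimately show ?thesis unfolding irreducible_representation_def by blast
qed

text \<open>A linear bijection of vector spaces is given by a matrix, and equivariance at the
  elements (1, a) is the intertwining relation.\<close>

lemma lifted_rep_isomorphic:
  assumes \<pi>: "proj_rep n \<pi>" and \<sigma>: "proj_rep p \<sigma>" and A1: "1 \<in> A"
    and iso: "representation_isomorphic (twisted_product A C G) (module_vec TYPE(complex) n)
      (lifted_rep n \<pi>) (module_vec TYPE(complex) p) (lifted_rep p \<sigma>)"
  shows "proj_rep_isomorphic n \<pi> p \<sigma>"
proof -
  from iso obtain T where T: "linear_map complex_field (module_vec TYPE(complex) n) (module_vec TYPE(complex) p) T"
    and bij: "bij_betw T (carrier_vec n) (carrier_vec p)"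
    and comm: "\<And>h x. \<lbrakk>h \<in> carrier (twisted_product A C G); x \<in> carrier_vec n\<rbrakk>
      \<Longrightarrow> T (lifted_rep n \<pi> h x) = lifted_rep p \<sigma> h (T x)"
    unfolding representation_isomorphic_def module_vec_simps by blast
  have hom: "T \<in> module_hom complex_field (module_vec TYPE(complex) n) (module_vec TYPE(complex) p)"
    using T by (simp add: linear_map_def mod_hom_def mod_hom_axioms_def)
  have Tc: "T x \<in> carrier_vec p" if "x \<in> carrier_vec n" for x
    using hom that by (auto simp: module_hom_def module_vec_simps)
  obtain M where M: "M \<in> carrier_mat p n" and TM: "\<And>x. x \<in> carrier_vec n \<Longrightarrow> T x = M *\<^sub>v x"
  proof (rule linear_on_vec_eq_mat[of n T p])
    show "T x \<in> carrier_vec p" if "x \<in> carrier_vec n" for x by (rule Tc[OF that])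
    show "T (x + y) = T x + T y" if "x \<in> carrier_vec n" "y \<in> carrier_vec n" for x y
      using hom that by (auto simp: module_hom_def module_vec_simps)
    show "T (c \<cdot>\<^sub>v x) = c \<cdot>\<^sub>v T x" if "x \<in> carrier_vec n" for c x
      using hom that by (auto simp: module_hom_def module_vec_simps)
  qed blast
  have "M * \<pi> a = \<sigma> a * M" if a: "a \<in> carrier G" for a
  proof (rule mat_eq_on_vecI[of _ p n])
    note \<pi>c = proj_rep_carrier[OF \<pi> a] and \<sigma>c = proj_rep_carrier[OF \<sigma> a]
    show "M * \<pi> a \<in> carrier_mat p n" "\<sigma> a * M \<in> carrier_mat p n" using M \<pi>c \<sigma>c by auto
    fix x :: "complex vec" assume x: "x \<in> carrier_vec n"
    have "T (\<pi> a *\<^sub>v x) = \<sigma> a *\<^sub>v T x"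
      using comm[of "(1, a)" x] a x A1 Tc[OF x] \<pi>c \<sigma>c
      by (simp add: twisted_product_def lifted_rep_apply)
    then show "M * \<pi> a *\<^sub>v x = \<sigma> a * M *\<^sub>v x"
      using TM[OF x] TM[OF mult_mat_vec_carrier[OF \<pi>c x]] assoc_mult_mat_vec[OF M \<pi>c x]
        assoc_mult_mat_vec[OF \<sigma>c M x] by simp
  qed
  moreover have "bij_betw (\<lambda>x. M *\<^sub>v x) (carrier_vec n) (carrier_vec p)"
    using bij TM bij_betw_cong[of "carrier_vec n" T "\<lambda>x. M *\<^sub>v x" "carrier_vec p"] by simp
  ultimately show ?thesis using M by (auto simp: proj_rep_isomorphic_def intertwiner_def)
qed

end

section \<open>Decomposition of W and the commutative case\<close>

theorem corollary1:
  fixes G :: "'g monoid" and W :: "(complex, 'w) module" and grade :: "'g \<Rightarrow> 'w set"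
    and v :: "'g \<Rightarrow> 'w" and C :: "'g \<Rightarrow> 'g \<Rightarrow> complex" and A :: "complex set"
  assumes "graded_twisted_algebra G W grade"
    and "finite (carrier G)"
    and associative: "\<And>x y z. \<lbrakk>x \<in> carrier W; y \<in> carrier W; z \<in> carrier W\<rbrakk>
      \<Longrightarrow> (x \<otimes>\<^bsub>W\<^esub> y) \<otimes>\<^bsub>W\<^esub> z = x \<otimes>\<^bsub>W\<^esub> (y \<otimes>\<^bsub>W\<^esub> z)"
    and "graded_basis G W grade v"
    and "structure_constant G W v C"
    and "subgroup A (mult_of complex_field)"
    and "\<And>a b. \<lbrakk>a \<in> carrier G; b \<in> carrier G\<rbrakk> \<Longrightarrow> C a b \<in> A"
  shows "\<exists>(m :: nat) (V :: nat \<Rightarrow> (complex, complex vec) module)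
            (\<rho> :: nat \<Rightarrow> complex \<times> 'g \<Rightarrow> complex vec \<Rightarrow> complex vec) (n :: nat \<Rightarrow> nat).
    (\<forall>i<m. irreducible_representation (twisted_product A C G) (V i) (\<rho> i) \<and>
           vectorspace.fin_dim complex_field (V i) \<and>
           n i = vectorspace.dim complex_field (V i)) \<and>
    (\<forall>i<m. \<forall>j<m. i \<noteq> j \<longrightarrow>
       \<not> representation_isomorphic (twisted_product A C G) (V i) (\<rho> i) (V j) (\<rho> j)) \<and>
    algebra_isomorphic W (product_algebra {..<m} (\<lambda>i. matrix_algebra (n i))) \<and>
    ((\<forall>x \<in> carrier W. \<forall>y \<in> carrier W. x \<otimes>\<^bsub>W\<^esub> y = y \<otimes>\<^bsub>W\<^esub> x) \<longleftrightarrow> (\<forall>i<m. n i = 1)) \<and>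
    ((\<forall>x \<in> carrier W. \<forall>y \<in> carrier W. x \<otimes>\<^bsub>W\<^esub> y = y \<otimes>\<^bsub>W\<^esub> x) \<longleftrightarrow>
       (\<exists>k :: nat. algebra_isomorphic W (product_algebra {..<k} (\<lambda>_. scalar_algebra))))"
proof -
  interpret graded_twisted_algebra G W grade by fact
  interpret twisted_algebra_basis G W grade v C
    by unfold_locales (use assms in auto)
  let ?H = "twisted_product A C G"
  have H: "group ?H"
    by (rule twisted_product_group[OF assms(1) associative assms(4-7)])
  have A0: "0 \<notin> A" and A1: "1 \<in> A"
    using subgroup.mem_carrier[OF assms(6)] subgroup.one_closed[OF assms(6)] by auto
  obtain m n \<pi> where fam: "tc.irred_family m n \<pi>"
    and complete: "\<And>k \<sigma>. tc.irred k \<sigma> \<Longrightarrow> \<exists>i<m. tc.proj_rep_isomorphic k \<sigma> (n i) (\<pi> i)"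
    using tc.exists_complete_irred_family by blast
  have irr: "tc.irred (n i) (\<pi> i)" if "i < m" for i using fam that by (simp add: tc.irred_family_def)
  have rep: "tc.proj_rep (n i) (\<pi> i)" and pos: "0 < n i" if "i < m" for i
    using irr[OF that] by (auto simp: tc.irred_def)
  let ?P = "product_algebra {..<m} (\<lambda>i. matrix_algebra (n i))"
  let ?comm = "\<forall>x \<in> carrier W. \<forall>y \<in> carrier W. x \<otimes>\<^bsub>W\<^esub> y = y \<otimes>\<^bsub>W\<^esub> x"
  let ?V = "\<lambda>i. module_vec TYPE(complex) (n i)" and ?\<rho> = "\<lambda>i. tc.lifted_rep (n i) (\<pi> i)"
  have iso: "algebra_isomorphic W ?P"
    using fam complete by (rule algebra_isomorphic_matrix_product)
  have comm_iff: "?comm \<longleftrightarrow> (\<forall>i<m. n i = 1)"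
    using algebra_isomorphic_commutative_iff[OF iso mult_closed] matrix_product_commutative_iff[of m n] pos
    by simp
  have dims: "vectorspace.fin_dim complex_field (?V i)" "n i = vectorspace.dim complex_field (?V i)" for i
  proof -
    interpret vs: vec_space "TYPE(complex)" "n i" .
    show "vectorspace.fin_dim complex_field (?V i)" by (rule vs.fin_dim)
    show "n i = vectorspace.dim complex_field (?V i)" by (rule vs.dim_is_n[symmetric])
  qed
  have irreducible: "irreducible_representation ?H (?V i) (?\<rho> i)" if "i < m" for i
    by (rule tc.irreducible_lifted_rep[OF irr[OF that] H A0 A1])
  have distinct: "\<not> representation_isomorphic ?H (?V i) (?\<rho> i) (?V j) (?\<rho> j)"
    if "i < m" "j < m" "i \<noteq> j" for i j
    using tc.lifted_rep_isomorphic[OF rep[OF that(1)] rep[OF that(2)] A1] fam that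
    by (auto simp: tc.irred_family_def)
  have scalar_iff: "?comm \<longleftrightarrow> (\<exists>k :: nat. algebra_isomorphic W (product_algebra {..<k} (\<lambda>_. scalar_algebra)))"
  proof
    assume ?comm
    then have "n i = 1" if "i < m" for i using comm_iff that by simp
    from algebra_isomorphic_trans[OF iso matrix_product_isomorphic_scalar_product[OF this]]
    show "\<exists>k :: nat. algebra_isomorphic W (product_algebra {..<k} (\<lambda>_. scalar_algebra))" by blast
  \<comment> \<open>Here k is unrelated to m: any product of copies of the scalars is commutative,
    and an isomorphism transports this to W.\<close>
  next
    assume "\<exists>k :: nat. algebra_isomorphic W (product_algebra {..<k} (\<lambda>_. scalar_algebra))"
    then obtain k :: nat where "algebra_isomorphic W (product_algebra {..<k} (\<lambda>_. scalar_algebra))" by blast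
    from algebra_isomorphic_commutative_iff[OF this mult_closed] show ?comm
      by (auto simp: product_algebra_def scalar_algebra_def mult.commute)
  qed
  show ?thesis
    by (intro exI[of _ m] exI[of _ ?V] exI[of _ ?\<rho>] exI[of _ n] conjI allI impI)
      (use irreducible dims distinct iso comm_iff scalar_iff in simp_all)
qed

end
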